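(* Let $A$ be a $C^{*}$-algebra (not assumed unital) and let $p\in A^{+}$ with $\|p\|=1$. Then $p$ has the order unit property in $A$ if and only if $p$ is a projection in $A$ (that is, $p=p^{*}=p^{2}$). In this case, $A_{p}=pAp$, where $pAp=\{pxp : x\in A\}$.
   Context: $A^{+}$ denotes the set of positive elements of the $C^{*}$-algebra $A$, and $M_{2}(A)^{+}$ the set of positive elements of the $C^{*}$-algebra $M_{2}(A)$ of $2\times 2$ matrices over $A$. For a nonzero $p\in A^{+}$ define $$A_{p}=\left\{x\in A : \begin{pmatrix} kp & x\\ x^{*} & kp\end{pmatrix}\in M_{2}(A)^{+}\ \text{for some real } k>0\right\}.$$ An element $p\in A^{+}$ with $\|p\|=1$ is said to have the order unit property in $A$ if for every $x\in A_{p}$, $$\begin{pmatrix} \|x\|\,p & x\\ x^{*} & \|x\|\,p\end{pmatrix}\in M_{2}(A)^{+}.$$ *)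

theory Defs
  imports Complex_Main
begin

class complex_star_algebra = ring +
  fixes scaleC :: "complex \<Rightarrow> 'a \<Rightarrow> 'a" (infixr "*\<^sub>C" 75)
    and star :: "'a \<Rightarrow> 'a"
  assumes scaleC_add_right: "c *\<^sub>C (x + y) = c *\<^sub>C x + c *\<^sub>C y"
    and scaleC_add_left: "(c + d) *\<^sub>C x = c *\<^sub>C x + d *\<^sub>C x"
    and scaleC_scaleC: "c *\<^sub>C d *\<^sub>C x = (c * d) *\<^sub>C x"
    and scaleC_one: "1 *\<^sub>C x = x"
    and mult_scaleC_left: "(c *\<^sub>C x) * y = c *\<^sub>C (x * y)"
    and mult_scaleC_right: "x * (c *\<^sub>C y) = c *\<^sub>C (x * y)"
    and star_star: "star (star x) = x"
    and star_add: "star (x + y) = star x + star y"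
    and star_scaleC: "star (c *\<^sub>C x) = cnj c *\<^sub>C star x"
    and star_mult: "star (x * y) = star y * star x"

text \<open>A C*-algebra, which need not have a unit.  Submultiplicativity of the norm and
  completeness are part of \<^class>\<open>real_normed_algebra\<close> and \<^class>\<open>banach\<close>.\<close>

class cstar_algebra = complex_star_algebra + real_normed_algebra + banach +
  assumes scaleR_scaleC: "r *\<^sub>R x = complex_of_real r *\<^sub>C x"
    and norm_scaleC: "norm (c *\<^sub>C x) = cmod c * norm x"
    and cstar_identity: "norm (star x * x) = (norm x)\<^sup>2"

text \<open>The pair \<open>(a, s)\<close> stands for \<open>a + s 1\<close> in the unitization \<open>A \<oplus> \<complex>\<close>, with unit \<open>(0, 1)\<close>.\<close>

definition unitization_mult ::
    "'a::complex_star_algebra \<times> complex \<Rightarrow> 'a \<times> complex \<Rightarrow> 'a \<times> complex"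
  where "unitization_mult u v =
    (fst u * fst v + snd v *\<^sub>C fst u + snd u *\<^sub>C fst v, snd u * snd v)"

definition unitization_invertible :: "'a::complex_star_algebra \<times> complex \<Rightarrow> bool"
  where "unitization_invertible u \<longleftrightarrow>
    (\<exists>v. unitization_mult u v = (0, 1) \<and> unitization_mult v u = (0, 1))"

text \<open>A unit is adjoined even if the algebra already has one; then the spectrum below is the
  usual one together with \<open>0\<close>, which makes no difference to positivity.\<close>

definition spectrum :: "'a::complex_star_algebra \<Rightarrow> complex set"
  where "spectrum a = {z. \<not> unitization_invertible (a, - z)}"

definition positive :: "'a::complex_star_algebra \<Rightarrow> bool"
  where "positive a \<longleftrightarrow> star a = a \<and> spectrum a \<subseteq> complex_of_real ` {0..}"

text \<open>The *-algebra of 2 by 2 matrices; \<open>Mat2 a b c d\<close> has rows \<open>(a, b)\<close> and \<open>(c, d)\<close>.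
  Over a C*-algebra it is again one for a unique norm, but that norm is not needed here:
  spectra, and hence positivity, depend only on the *-algebra structure.\<close>

datatype 'a mat2 = Mat2 (m11: 'a) (m12: 'a) (m21: 'a) (m22: 'a)

instantiation mat2 :: (complex_star_algebra) complex_star_algebra
begin

definition zero_mat2 :: "'a mat2" where "0 = Mat2 0 0 0 0"

definition plus_mat2 :: "'a mat2 \<Rightarrow> 'a mat2 \<Rightarrow> 'a mat2"
  where "M + N = Mat2 (m11 M + m11 N) (m12 M + m12 N) (m21 M + m21 N) (m22 M + m22 N)"

definition minus_mat2 :: "'a mat2 \<Rightarrow> 'a mat2 \<Rightarrow> 'a mat2"
  where "M - N = Mat2 (m11 M - m11 N) (m12 M - m12 N) (m21 M - m21 N) (m22 M - m22 N)"

definition uminus_mat2 :: "'a mat2 \<Rightarrow> 'a mat2"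
  where "- M = Mat2 (- m11 M) (- m12 M) (- m21 M) (- m22 M)"

definition times_mat2 :: "'a mat2 \<Rightarrow> 'a mat2 \<Rightarrow> 'a mat2"
  where "M * N = Mat2
    (m11 M * m11 N + m12 M * m21 N) (m11 M * m12 N + m12 M * m22 N)
    (m21 M * m11 N + m22 M * m21 N) (m21 M * m12 N + m22 M * m22 N)"

definition scaleC_mat2 :: "complex \<Rightarrow> 'a mat2 \<Rightarrow> 'a mat2"
  where "c *\<^sub>C M = Mat2 (c *\<^sub>C m11 M) (c *\<^sub>C m12 M) (c *\<^sub>C m21 M) (c *\<^sub>C m22 M)"

definition star_mat2 :: "'a mat2 \<Rightarrow> 'a mat2"
  where "star M = Mat2 (star (m11 M)) (star (m21 M)) (star (m12 M)) (star (m22 M))"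

instance
  by standard
    (simp_all add: zero_mat2_def plus_mat2_def minus_mat2_def uminus_mat2_def times_mat2_def
      scaleC_mat2_def star_mat2_def mat2.expand algebra_simps
      scaleC_add_right scaleC_add_left scaleC_scaleC scaleC_one mult_scaleC_left
      mult_scaleC_right star_star star_add star_scaleC star_mult)

end

definition dominated_by :: "'a::cstar_algebra \<Rightarrow> 'a set"
  where "dominated_by p =
    {x. \<exists>k::real. k > 0 \<and> positive (Mat2 (k *\<^sub>R p) x (star x) (k *\<^sub>R p))}"

definition order_unit_property :: "'a::cstar_algebra \<Rightarrow> bool"
  where "order_unit_property p \<longleftrightarrow> positive p \<and> norm p = 1 \<and>
    (\<forall>x\<in>dominated_by p. positive (Mat2 (norm x *\<^sub>R p) x (star x) (norm x *\<^sub>R p)))"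

definition is_projection :: "'a::complex_star_algebra \<Rightarrow> bool"
  where "is_projection p \<longleftrightarrow> star p = p \<and> p * p = p"

end

theory Submission
  imports Defs "HOL-Analysis.Operator_Norm" "HOL-Analysis.Topology_Euclidean_Space"
    "HOL-Computational_Algebra.Fundamental_Theorem_Algebra"
begin

text \<open>Positivity in \<open>M\<^sub>2(A)\<close> is a statement about spectra only, so no norm on \<open>M\<^sub>2(A)\<close> is used:
  everything is reduced to block inverses with entries in the unitization of \<open>A\<close>, which is a
  unital C*-algebra.

  If \<open>p\<close> has the order unit property, test it on \<open>x = p - p\<^sup>2\<close> with \<open>s = \<parallel>x\<parallel>\<close>: conjugating by the
  Hadamard unitary, positivity of the matrix says \<open>s p \<plusminus> x \<ge> 0\<close>, and evaluating on the spectrum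
  of \<open>p\<close> forces \<open>s = 0\<close>.  Conversely let \<open>p\<close> be a projection.  If \<open>x \<in> A\<^sub>p\<close>, the Schur complements
  of \<open>k p + t\<close> stay positive as \<open>t\<close> decreases to \<open>0\<close>, and in the limit
  \<open>x\<^sup>* (1 - p) x \<le> 0\<close>, whence \<open>p x = x\<close>; likewise \<open>x p = x\<close>.  For such \<open>x\<close> the off-diagonal part squares
  to \<open>diag (x x\<^sup>*, x\<^sup>* x)\<close>, so its spectrum lies in \<open>[-\<parallel>x\<parallel>, \<parallel>x\<parallel>]\<close>.\<close>

subsection \<open>Scalars and the involution\<close>

text \<open>Unital C*-algebras. The spectral theory is developed here and later applied to the
  unitization.\<close>

class cstar_algebra_1 = cstar_algebra + real_normed_algebra_1

lemma scaleC_zero_left [simp]: "0 *\<^sub>C (x::'a::complex_star_algebra) = 0"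
  using scaleC_add_left[of 0 0 x] by simp

lemma scaleC_zero_right [simp]: "c *\<^sub>C (0::'a::complex_star_algebra) = 0"
  using scaleC_add_right[of c 0 "0::'a"] by simp

lemma scaleC_minus_left: "(- c) *\<^sub>C (x::'a::complex_star_algebra) = - (c *\<^sub>C x)"
  using scaleC_add_left[of c "- c" x] by (simp add: eq_neg_iff_add_eq_0 add.commute)

lemma scaleC_minus_right: "c *\<^sub>C (- x::'a::complex_star_algebra) = - (c *\<^sub>C x)"
  using scaleC_add_right[of c x "- x"] by (simp add: eq_neg_iff_add_eq_0 add.commute)

lemma scaleC_diff_left: "(c - d) *\<^sub>C (x::'a::complex_star_algebra) = c *\<^sub>C x - d *\<^sub>C x"
  using scaleC_add_left[of c "- d" x] by (simp add: scaleC_minus_left)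

lemma scaleC_diff_right: "c *\<^sub>C (x - y::'a::complex_star_algebra) = c *\<^sub>C x - c *\<^sub>C y"
  using scaleC_add_right[of c x "- y"] by (simp add: scaleC_minus_right)

lemma star_zero [simp]: "star (0::'a::complex_star_algebra) = 0"
  using star_add[of 0 "0::'a"] by simp

lemma star_minus: "star (- x::'a::complex_star_algebra) = - star x"
  using star_add[of x "- x"] by (simp add: eq_neg_iff_add_eq_0 add.commute)

lemma star_diff: "star (x - y::'a::complex_star_algebra) = star x - star y"
  using star_add[of x "- y"] by (simp add: star_minus)

lemma norm_star [simp]: "norm (star (x::'a::cstar_algebra)) = norm x"
proof -
  have le: "norm y \<le> norm (star y)" for y :: 'a
  proof (cases "y = 0")
    case False
    have "norm y * norm y \<le> norm (star y) * norm y"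
      using norm_mult_ineq[of "star y" y] by (simp add: cstar_identity power2_eq_square)
    then show ?thesis using False by simp
  qed simp
  show ?thesis using le[of x] le[of "star x"] by (simp add: star_star)
qed

lemma cstar_identity': "norm (x * star x) = (norm (x::'a::cstar_algebra))\<^sup>2"
  using cstar_identity[of "star x"] by (simp add: star_star)

definition of_complex :: "complex \<Rightarrow> 'a::cstar_algebra_1"
  where "of_complex z = z *\<^sub>C 1"

lemma of_complex_0 [simp]: "of_complex 0 = 0"
  and of_complex_1 [simp]: "of_complex 1 = 1"
  and of_complex_add: "of_complex (z + w) = of_complex z + of_complex w"
  and of_complex_diff: "of_complex (z - w) = of_complex z - of_complex w"
  and of_complex_minus: "of_complex (- z) = - of_complex z"
  and of_complex_mult: "of_complex (z * w) = of_complex z * of_complex w"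
  and of_complex_mult_left: "of_complex z * a = z *\<^sub>C a"
  and of_complex_mult_right: "a * of_complex z = z *\<^sub>C a"
  and norm_of_complex [simp]: "norm (of_complex z :: 'a::cstar_algebra_1) = cmod z"
  for a :: "'a::cstar_algebra_1"
  by (simp_all add: of_complex_def scaleC_one scaleC_add_left scaleC_diff_left scaleC_minus_left
      mult_scaleC_left mult_scaleC_right scaleC_scaleC norm_scaleC mult.commute)

lemma star_one [simp]: "star (1::'a::cstar_algebra_1) = 1"
  using star_mult[of "star 1" "1::'a"] by (simp add: star_star)

lemma star_of_complex: "star (of_complex z :: 'a::cstar_algebra_1) = of_complex (cnj z)"
  by (simp add: of_complex_def star_scaleC)

lemma of_real_of_complex: "of_real r = (of_complex (complex_of_real r) :: 'a::cstar_algebra_1)"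
  by (simp add: of_complex_def of_real_def scaleR_scaleC)

subsection \<open>Invertibility\<close>

definition inverse_pair :: "'a::ring_1 \<Rightarrow> 'a \<Rightarrow> bool"
  where "inverse_pair u v \<longleftrightarrow> u * v = 1 \<and> v * u = 1"

definition has_inverse :: "'a::ring_1 \<Rightarrow> bool"
  where "has_inverse u \<longleftrightarrow> (\<exists>v. inverse_pair u v)"

lemma left_right_inverse_eq: "v * u = 1 \<Longrightarrow> u * w = 1 \<Longrightarrow> v = (w::'a::ring_1)"
  by (metis mult.assoc mult.left_neutral mult.right_neutral)

lemma has_inverseI: "v * u = 1 \<Longrightarrow> u * w = 1 \<Longrightarrow> has_inverse (u::'a::ring_1)"
  using left_right_inverse_eq[of v u w] by (auto simp: has_inverse_def inverse_pair_def)

lemma not_has_inverse_zero: "\<not> has_inverse (0::'a::ring_1)"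
  by (simp add: has_inverse_def inverse_pair_def)

lemma has_inverse_mult:
  assumes "has_inverse u" "has_inverse (v::'a::ring_1)"
  shows "has_inverse (u * v)"
proof -
  obtain u' v' where u: "u * u' = 1" "u' * u = 1" and v: "v * v' = 1" "v' * v = 1"
    using assms by (auto simp: has_inverse_def inverse_pair_def)
  show ?thesis
  proof (rule has_inverseI)
    show "(v' * u') * (u * v) = 1"
      by (metis u(2) v(2) mult.assoc mult.left_neutral)
    show "(u * v) * (v' * u') = 1"
      by (metis u(1) v(1) mult.assoc mult.left_neutral)
  qed
qed

text \<open>If \<open>w\<close> inverts the product, commutation makes \<open>w * q\<close> a left
  inverse and \<open>q * w\<close> a right inverse of \<open>u\<close>.\<close>

lemma has_inverse_factor:
  assumes "has_inverse (u * q)" "u * q = q * (u::'a::ring_1)"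
  shows "has_inverse u"
proof -
  obtain w where w: "(u * q) * w = 1" "w * (u * q) = 1"
    using assms(1) by (auto simp: has_inverse_def inverse_pair_def)
  show ?thesis
  proof (rule has_inverseI)
    show "(w * q) * u = 1" using w(2) assms(2) by (simp add: mult.assoc)
    show "u * (q * w) = 1" using w(1) by (simp add: mult.assoc)
  qed
qed

lemma has_inverse_of_complex: "z \<noteq> 0 \<Longrightarrow> has_inverse (of_complex z :: 'a::cstar_algebra_1)"
  by (rule has_inverseI[of "of_complex (inverse z)" _ "of_complex (inverse z)"])
    (simp_all flip: of_complex_mult)

lemma has_inverse_minus: "has_inverse (- u) \<longleftrightarrow> has_inverse (u::'a::ring_1)"
proof -
  have "has_inverse (- u)" if inv: "has_inverse u" for u :: 'a
  proof -
    obtain v where "inverse_pair u v" using inv by (auto simp: has_inverse_def)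
    then have "u * v = 1" "v * u = 1" by (simp_all add: inverse_pair_def)
    then show ?thesis by (intro has_inverseI[of "- v" _ "- v"]) simp_all
  qed
  from this[of u] this[of "- u"] show ?thesis by auto
qed

text \<open>The inverse is the Neumann series of \<open>h\<close>.\<close>

lemma has_inverse_one_minus:
  fixes h :: "'a::{banach,real_normed_algebra_1}"
  assumes "norm h < 1"
  shows "has_inverse (1 - h)"
proof -
  have "summable (\<lambda>n. norm (h ^ n))"
    by (rule summable_comparison_test'[of "\<lambda>n. norm h ^ n" 0])
      (use assms in \<open>simp_all add: norm_power_ineq summable_geometric\<close>)
  then have s: "summable (\<lambda>n. h ^ n)" by (rule summable_norm_cancel)
  have split: "suminf (\<lambda>n. h ^ n) = 1 + suminf (\<lambda>n. h ^ Suc n)"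
    using suminf_split_head[OF s] by simp
  have "h * suminf (\<lambda>n. h ^ n) = suminf (\<lambda>n. h ^ Suc n)"
    using suminf_mult[OF s, of h] by simp
  moreover have "suminf (\<lambda>n. h ^ n) * h = suminf (\<lambda>n. h ^ Suc n)"
    using suminf_mult2[OF s, of h] by (simp add: power_commutes)
  ultimately show ?thesis
    using split
    by (intro has_inverseI[of "suminf (\<lambda>n. h ^ n)" _ "suminf (\<lambda>n. h ^ n)"])
      (simp_all add: algebra_simps)
qed

text \<open>The resolvent identity bounds the difference by
  \<open>norm v' * norm (w - u) * norm v\<close>. Smallness of the perturbation turns this into
  \<open>norm v' \<le> 2 * norm v\<close>, which is fed back into the same bound.\<close>

lemma norm_perturbed_inverse_le:
  fixes u :: "'a::real_normed_algebra_1"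
  assumes "inverse_pair u v" "inverse_pair w v'" "norm (w - u) * norm v \<le> 1 / 2"
  shows "norm (v' - v) \<le> 2 * norm v ^ 2 * norm (w - u)"
proof -
  have eq: "v' - v = - (v' * (w - u) * v)"
    using assms(1,2) by (simp add: inverse_pair_def algebra_simps)
  have b: "norm (v' - v) \<le> norm v' * norm (w - u) * norm v"
    unfolding eq norm_minus_cancel
    by (rule order_trans[OF norm_mult_ineq]) (simp add: mult_right_mono norm_mult_ineq)
  also have "\<dots> \<le> norm v' * (1 / 2)"
    using assms(3) by (simp only: mult.assoc) (intro mult_left_mono, simp_all)
  finally have "norm v' \<le> 2 * norm v"
    using norm_triangle_ineq2[of v' v] by linarith
  then have "norm v' * (norm (w - u) * norm v) \<le> 2 * norm v * (norm (w - u) * norm v)"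
    by (intro mult_right_mono) simp_all
  with b show ?thesis by (simp add: power2_eq_square algebra_simps)
qed

lemma has_inverse_perturb:
  fixes u :: "'a::{banach,real_normed_algebra_1}"
  assumes "inverse_pair u v" "norm (w - u) * norm v < 1"
  shows "has_inverse w"
proof -
  have "norm (v * (u - w)) < 1"
    using norm_mult_ineq[of v "u - w"] assms(2) by (simp add: norm_minus_commute mult.commute)
  then have "has_inverse (1 - v * (u - w))" by (rule has_inverse_one_minus)
  moreover have "has_inverse u" using assms(1) by (auto simp: has_inverse_def)
  moreover have "w = u * (1 - v * (u - w))"
    using assms(1) by (simp add: inverse_pair_def right_diff_distrib flip: mult.assoc)
  ultimately show ?thesis using has_inverse_mult by metis
qed

subsection \<open>The spectrum in a unital algebra\<close>

definition sp :: "'a::cstar_algebra_1 \<Rightarrow> complex set"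
  where "sp a = {z. \<not> has_inverse (a - of_complex z)}"

lemma sp_norm_le:
  fixes a :: "'a::cstar_algebra_1"
  assumes "z \<in> sp a"
  shows "cmod z \<le> norm a"
proof (rule ccontr)
  assume "\<not> ?thesis"
  then have lt: "norm a < cmod z" and "z \<noteq> 0" using norm_ge_zero[of a] by (auto simp del: norm_ge_zero)
  then have "norm (inverse z *\<^sub>C a) < 1"
    using divide_less_eq_1_pos[of "cmod z" "norm a"]
    by (simp add: norm_scaleC norm_inverse divide_inverse mult.commute)
  then have "has_inverse (of_complex (- z) * (1 - inverse z *\<^sub>C a))"
    using \<open>z \<noteq> 0\<close> by (intro has_inverse_mult has_inverse_of_complex has_inverse_one_minus) simp_all
  moreover have "of_complex (- z) * (1 - inverse z *\<^sub>C a) = a - of_complex z"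
    using \<open>z \<noteq> 0\<close> by (simp add: of_complex_mult_left scaleC_diff_right scaleC_scaleC scaleC_one)
      (simp add: of_complex_def scaleC_minus_left scaleC_scaleC scaleC_one)
  ultimately show False using assms by (simp add: sp_def)
qed

section \<open>Polynomial calculus and spectral mapping\<close>

definition peval :: "complex poly \<Rightarrow> 'a::cstar_algebra_1 \<Rightarrow> 'a"
  where "peval p a = fold_coeffs (\<lambda>c y. of_complex c + a * y) p 0"

lemma peval_0 [simp]: "peval 0 a = 0"
  by (simp add: peval_def)

lemma peval_pCons [simp]: "peval (pCons c p) a = of_complex c + a * peval p a"
  by (cases "p = 0 \<and> c = 0") (auto simp: peval_def)

lemma peval_add: "peval (p + q) a = peval p a + peval q a"
  by (induction p q rule: poly_induct2) (simp_all add: of_complex_add algebra_simps)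

lemma peval_smult: "peval (smult c p) a = c *\<^sub>C peval p a"
  by (induction p)
    (simp_all add: of_complex_mult of_complex_mult_left scaleC_add_right mult_scaleC_right)

lemma peval_mult: "peval (p * q) a = peval p a * peval q a"
  by (induction p)
    (simp_all add: peval_add peval_smult of_complex_mult_left distrib_right mult.assoc)

lemma peval_commute: "peval p a * peval q a = peval q a * peval p a"
  by (metis peval_mult mult.commute)

text \<open>Over the complex numbers \<open>p\<close> splits into linear factors, and each of them
  evaluates to an invertible element. The induction splits off one root at a time.\<close>

lemma has_inverse_peval:
  fixes a :: "'a::cstar_algebra_1"
  assumes "p \<noteq> 0" "\<And>z. poly p z = 0 \<Longrightarrow> z \<notin> sp a"
  shows "has_inverse (peval p a)"
  using assms
proof (induction "degree p" arbitrary: p)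
  case 0
  then obtain c where "p = [:c:]" using degree_eq_zeroE by metis
  then show ?case using 0 by (simp add: has_inverse_of_complex)
next
  case (Suc n)
  then obtain z where z: "poly p z = 0"
    using fundamental_theorem_of_algebra[of p] by (auto simp: constant_degree)
  then obtain q where q: "p = [:- z, 1:] * q" by (auto simp: poly_eq_0_iff_dvd dvd_def)
  have "q \<noteq> 0" using q Suc.prems(1) by auto
  then have "degree p = Suc (degree q)" unfolding q by (subst degree_mult_eq) simp_all
  then have "n = degree q" using Suc.hyps(2) by simp
  then have "has_inverse (peval q a)"
    by (rule Suc.hyps(1)) (use \<open>q \<noteq> 0\<close> Suc.prems(2) q in auto)
  moreover have "has_inverse (peval [:- z, 1:] a)"
    using Suc.prems(2)[OF z] by (simp add: sp_def of_complex_minus)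
  ultimately show ?case unfolding q peval_mult by (rule has_inverse_mult[rotated])
qed

text \<open>If \<open>p - w\<close> had no root in the spectrum, \<open>has_inverse_peval\<close>
  would invert its value at \<open>a\<close>. Positive degree guarantees that \<open>p - w\<close>
  is not the zero polynomial.\<close>

lemma sp_pevalE:
  fixes a :: "'a::cstar_algebra_1"
  assumes "w \<in> sp (peval p a)" "0 < degree p"
  obtains z where "z \<in> sp a" "poly p z = w"
proof -
  have ev: "peval (p + [:- w:]) a = peval p a - of_complex w"
    by (simp add: peval_add of_complex_minus)
  have "p + [:- w:] \<noteq> 0"
    using assms(2) by (metis add_eq_0_iff degree_minus degree_pCons_0 less_irrefl)
  then show ?thesis
    using has_inverse_peval[of "p + [:- w:]" a] assms(1) that
    unfolding ev sp_def by (auto simp: sp_def)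
qed

text \<open>\<open>a - z\<close> is a commuting factor of the value of \<open>p - poly p z\<close>
  at \<open>a\<close>, so invertibility of that value would pass to it.\<close>

lemma poly_in_sp_peval:
  fixes a :: "'a::cstar_algebra_1"
  assumes "z \<in> sp a"
  shows "poly p z \<in> sp (peval p a)"
proof -
  have ev: "peval (p + [:- poly p z:]) a = peval p a - of_complex (poly p z)"
    by (simp add: peval_add of_complex_minus)
  have "poly (p + [:- poly p z:]) z = 0" by simp
  then obtain q where q: "p + [:- poly p z:] = [:- z, 1:] * q"
    unfolding poly_eq_0_iff_dvd dvd_def by blast
  have "peval [:- z, 1:] a = a - of_complex z" by (simp add: of_complex_minus)
  then have "has_inverse (a - of_complex z)" if "has_inverse (peval p a - of_complex (poly p z))"
    using that has_inverse_factor[of "peval [:- z, 1:] a" "peval q a"] peval_commute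
    unfolding ev[symmetric] q peval_mult by metis
  then show ?thesis using assms by (auto simp: sp_def)
qed

text \<open>Arens' trick: shifting by \<open>\<i> * l\<close> moves \<open>z\<close> to a point of
  squared modulus at least \<open>(Im z + l)^2\<close>, while the C*-identity bounds the squared
  norm of the shifted element by \<open>m^2 + l^2\<close>. The terms \<open>l^2\<close> cancel, and
  what remains is linear in \<open>l\<close> yet bounded.\<close>

lemma sp_self_adjoint_real:
  fixes a :: "'a::cstar_algebra_1"
  assumes "star a = a" "z \<in> sp a"
  shows "Im z = 0"
proof (rule ccontr)
  assume im: "Im z \<noteq> 0"
  define m where "m = norm a"
  have key: "2 * Im z * l \<le> m\<^sup>2" for l :: real
  proof -
    define w where "w = \<i> * complex_of_real l"
    have "z + w \<in> sp (a + of_complex w)"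
      using poly_in_sp_peval[OF assms(2), of "[:w, 1:]"] by (simp add: add.commute)
    then have "cmod (z + w) \<le> norm (a + of_complex w)" by (rule sp_norm_le)
    then have "(cmod (z + w))\<^sup>2 \<le> (norm (a + of_complex w))\<^sup>2" by (simp add: power_mono)
    also have "\<dots> = norm (star (a + of_complex w) * (a + of_complex w))"
      by (simp add: cstar_identity)
    also have "star (a + of_complex w) * (a + of_complex w) = a * a + of_complex (complex_of_real (l\<^sup>2))"
    proof -
      have "cnj w * w = complex_of_real (l\<^sup>2)"
        by (simp add: w_def complex_eq_iff power2_eq_square)
      then have "of_complex (cnj w) * of_complex w = (of_complex (complex_of_real (l\<^sup>2)) :: 'a)"
        by (simp flip: of_complex_mult)
      moreover have "of_complex (cnj w) * a + a * of_complex w = 0"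
        by (simp add: of_complex_mult_left of_complex_mult_right w_def scaleC_minus_left)
      ultimately show ?thesis
        by (simp add: star_add star_of_complex assms(1) algebra_simps)
    qed
    also have "norm \<dots> \<le> m * m + l\<^sup>2"
      unfolding m_def
      by (rule norm_triangle_mono[OF norm_mult_ineq]) (simp add: norm_power)
    also have "(cmod (z + w))\<^sup>2 = (Re z)\<^sup>2 + (Im z + l)\<^sup>2"
      by (simp add: cmod_power2 w_def)
    finally have "2 * Im z * l \<le> m\<^sup>2 - (Re z)\<^sup>2 - (Im z)\<^sup>2"
      by (simp add: power2_eq_square algebra_simps)
    then show ?thesis using zero_le_power2[of "Re z"] zero_le_power2[of "Im z"] by linarith
  qed
  show False using key[of "(m\<^sup>2 + 1) / (2 * Im z)"] im by simp
qed

text \<open>The partial fraction of \<open>1 / (1 - c^2)\<close>; it is the doubling step when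
  resolvents are averaged over roots of unity.\<close>

lemma inverse_pair_average:
  fixes c g h :: "'a::cstar_algebra_1"
  assumes "inverse_pair (1 - c) g" "inverse_pair (1 + c) h"
  shows "inverse_pair (1 - c * c) ((1 / 2) *\<^sub>R (g + h))"
proof -
  have g: "(1 - c) * g = 1" "g * (1 - c) = 1" and h: "(1 + c) * h = 1" "h * (1 + c) = 1"
    using assms by (auto simp: inverse_pair_def)
  have "1 - c * c = (1 + c) * (1 - c)" "1 - c * c = (1 - c) * (1 + c)"
    by (simp_all add: algebra_simps)
  then have "(1 - c * c) * g = 1 + c" "(1 - c * c) * h = 1 - c"
    "g * (1 - c * c) = 1 + c" "h * (1 - c * c) = 1 - c"
    using g h by (metis mult.assoc mult.left_neutral mult.right_neutral)+
  then have "(1 - c * c) * (g + h) = 2" "(g + h) * (1 - c * c) = 2"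
    by (simp_all only: distrib_left distrib_right) simp_all
  moreover have "(1 / 2) *\<^sub>R (2::'a) = 1"
    by (metis scaleR_half_double one_add_one)
  ultimately show ?thesis
    by (simp add: inverse_pair_def)
qed

text \<open>If \<open>1 - z b\<close> were invertible on the whole closed unit disc, then averaging resolvents over
  \<open>2\<^sup>k\<close>-th roots of unity gives the inverse of \<open>1 - (z b)\<^bsup>n\<^esup>\<close> for \<open>n = 2\<^sup>k\<close>, with a modulus of continuity that
  does not depend on \<open>k\<close>.  For \<open>|z| < 1\<close> these inverses tend to \<open>1\<close>, at \<open>z = 1\<close> they stay away
  from \<open>1\<close> because \<open>b\<^bsup>n\<^esup>\<close> still has norm \<open>1\<close>.\<close>

lemma sp_norm_attained_normalized:
  fixes b :: "'a::cstar_algebra_1"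
  assumes sa: "star b = b" and nb: "norm b = 1"
  shows "\<exists>z. cmod z = 1 \<and> z \<in> sp b"
proof (rule ccontr)
  assume no: "\<not> ?thesis"
  have inv: "has_inverse (1 - z *\<^sub>C b)" if z: "cmod z \<le> 1" for z
  proof (cases "cmod z < 1")
    case True
    then show ?thesis by (intro has_inverse_one_minus) (simp add: norm_scaleC nb)
  next
    case False
    then have z1: "cmod z = 1" "z \<noteq> 0" using z by auto
    then have "inverse z \<notin> sp b" using no by (auto simp: norm_inverse)
    then have "has_inverse (of_complex (- z) * (b - of_complex (inverse z)))"
      using z1 by (intro has_inverse_mult has_inverse_of_complex) (simp_all add: sp_def)
    moreover have "of_complex (- z) * (b - of_complex (inverse z)) = 1 - z *\<^sub>C b"
      using z1 by (simp add: right_diff_distrib of_complex_mult_left[of _ b] scaleC_minus_left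
          flip: of_complex_mult) (simp add: of_complex_minus)
    ultimately show ?thesis by simp
  qed
  define F where "F z = (SOME v. inverse_pair (1 - z *\<^sub>C b) v)" for z
  have F: "inverse_pair (1 - z *\<^sub>C b) (F z)" if "cmod z \<le> 1" for z
    unfolding F_def using inv[OF that] unfolding has_inverse_def by (rule someI_ex)
  have "continuous_on (cball 0 1) F"
    unfolding continuous_on_iff
  proof (intro ballI allI impI)
    fix z :: complex and e :: real
    assume z: "z \<in> cball 0 1" and e: "0 < e"
    define B where "B = norm (F z) + 1"
    have B: "B > 0" "norm (F z) \<le> B" by (simp_all add: B_def add_nonneg_pos)
    \<comment> \<open>The first bound meets the smallness hypothesis of
      \<open>norm_perturbed_inverse_le\<close>, the second makes its conclusion at most
      \<open>e / 2\<close>.\<close>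
    define d where "d = min (1 / (2 * B)) (e / (4 * B\<^sup>2))"
    have d: "d > 0" "d \<le> 1 / (2 * B)" "d \<le> e / (4 * B\<^sup>2)" using B e by (auto simp: d_def)
    have "dist (F w) (F z) < e" if w: "w \<in> cball 0 1" "dist w z < d" for w
    proof -
      have "(1 - w *\<^sub>C b) - (1 - z *\<^sub>C b) = (z - w) *\<^sub>C b" by (simp add: scaleC_diff_left)
      then have n: "norm ((1 - w *\<^sub>C b) - (1 - z *\<^sub>C b)) = cmod (w - z)"
        by (simp add: norm_scaleC nb norm_minus_commute)
      have wz: "cmod (w - z) < d" using w by (simp add: dist_norm)
      have "cmod (w - z) * norm (F z) \<le> 1 / (2 * B) * B"
        by (rule mult_mono) (use wz d B in auto)
      also have "\<dots> = 1 / 2" using B by simp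
      finally have "norm (F w - F z) \<le> 2 * norm (F z) ^ 2 * cmod (w - z)"
        using norm_perturbed_inverse_le[of "1 - z *\<^sub>C b" "F z" "1 - w *\<^sub>C b" "F w"] F z w n by simp
      also have "\<dots> \<le> 2 * B\<^sup>2 * (e / (4 * B\<^sup>2))"
        by (intro mult_mono power_mono) (use wz d B e in auto)
      also have "\<dots> = e / 2" using B by simp
      finally show ?thesis using e by (simp add: dist_norm)
    qed
    then show "\<exists>d>0. \<forall>w\<in>cball 0 1. dist w z < d \<longrightarrow> dist (F w) (F z) < e" using d by blast
  qed
  then have "uniformly_continuous_on (cball 0 1) F"
    by (rule compact_uniformly_continuous) simp
  then obtain d where d: "d > 0"
    "\<And>z w. z \<in> cball 0 1 \<Longrightarrow> w \<in> cball 0 1 \<Longrightarrow> dist w z < d \<Longrightarrow> dist (F w) (F z) < 1/4"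
    unfolding uniformly_continuous_on_def by (metis zero_less_divide_1_iff zero_less_numeral)
  \<comment> \<open>Close enough to 1 that \<open>z\<close> and \<open>t * z\<close> are less than
    \<open>d\<close> apart on the disc, but below 1, so that the powers of \<open>t\<close> tend to
    0. The cap \<open>1 / 2\<close> keeps \<open>t\<close> positive.\<close>
  define t where "t = 1 - min (d / 2) (1 / 2)"
  have t: "0 < t" "t < 1" "1 - t < d" using d(1) by (auto simp: t_def)
  have le: "cmod (complex_of_real t * z) \<le> 1" if "cmod z \<le> 1" for z
    using that t by (simp add: norm_mult mult_le_one)
  have avg: "\<exists>G. \<forall>z. cmod z \<le> 1 \<longrightarrow> inverse_pair (1 - z ^ 2 ^ k *\<^sub>C b ^ 2 ^ k) (G z)
      \<and> norm (G z - G (complex_of_real t * z)) \<le> 1/4" for k :: nat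
  proof (induction k)
    case 0
    have "norm (F z - F (complex_of_real t * z)) \<le> 1/4" if z: "cmod z \<le> 1" for z
    proof -
      have "dist z (complex_of_real t * z) = cmod (complex_of_real (1 - t) * z)"
        by (simp add: dist_norm algebra_simps)
      also have "\<dots> = (1 - t) * cmod z"
        using t by (simp only: norm_mult norm_of_real)
      also have "\<dots> \<le> 1 - t" using z t by (simp add: mult_left_le)
      finally have "dist z (complex_of_real t * z) < d" using t by simp
      then show ?thesis using d(2)[of "complex_of_real t * z" z] z le[OF z] by (simp add: dist_norm)
    qed
    then show ?case using F by auto
  next
    case (Suc k)
    define n :: nat where "n = 2 ^ k"
    obtain G where G: "\<And>z. cmod z \<le> 1 \<Longrightarrow> inverse_pair (1 - z ^ n *\<^sub>C b ^ n) (G z)"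
      "\<And>z. cmod z \<le> 1 \<Longrightarrow> norm (G z - G (complex_of_real t * z)) \<le> 1/4"
      using Suc unfolding n_def by auto
    \<comment> \<open>Rotation by \<open>w\<close> changes the sign of \<open>z ^ n\<close>, so
      \<open>G (w * z)\<close> inverts \<open>1 + c\<close> where \<open>G z\<close> inverts
      \<open>1 - c\<close>.\<close>
    define w where "w = cis (pi / n)"
    have w: "cmod w = 1" "w ^ n = -1"
      by (simp_all add: w_def Complex.DeMoivre n_def)
    define H where "H z = (1 / 2) *\<^sub>R (G z + G (w * z))" for z
    have "inverse_pair (1 - z ^ (n * 2) *\<^sub>C b ^ (n * 2)) (H z)" if z: "cmod z \<le> 1" for z
    proof -
      define c where "c = z ^ n *\<^sub>C b ^ n"
      have wz: "cmod (w * z) \<le> 1" using z w by (simp add: norm_mult)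
      have w': "1 - (w * z) ^ n *\<^sub>C b ^ n = 1 + c"
        by (simp add: power_mult_distrib w c_def scaleC_minus_left)
      have "c * c = z ^ (n * 2) *\<^sub>C b ^ (n * 2)"
        by (simp add: c_def mult_scaleC_left mult_scaleC_right scaleC_scaleC power_mult power2_eq_square)
      then show ?thesis
        using inverse_pair_average[OF G(1)[OF z, folded c_def] G(1)[OF wz, unfolded w']]
        by (simp add: H_def)
    qed
    moreover have "norm (H z - H (complex_of_real t * z)) \<le> 1/4" if z: "cmod z \<le> 1" for z
    proof -
      have wz: "cmod (w * z) \<le> 1" using z w by (simp add: norm_mult)
      have "H z - H (complex_of_real t * z)
          = (1 / 2) *\<^sub>R ((G z - G (complex_of_real t * z)) + (G (w * z) - G (complex_of_real t * (w * z))))"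
        by (simp add: H_def algebra_simps)
      also have "norm \<dots> \<le> (1 / 2) * (1 / 4 + 1 / 4)"
        unfolding norm_scaleR
        by (intro mult_mono norm_triangle_mono G(2) z wz) simp_all
      finally show ?thesis by simp
    qed
    ultimately show ?case unfolding n_def by (intro exI[of _ H]) (simp add: mult.commute)
  qed
  obtain k0 where "t ^ k0 < 1/8" using real_arch_pow_inv[of "1/8" t] t by auto
  moreover have "t ^ 2 ^ k0 \<le> t ^ k0" by (rule power_decreasing) (use t in auto)
  ultimately have tk: "t ^ 2 ^ k0 < 1/8" by simp
  define n :: nat where "n = 2 ^ k0"
  \<comment> \<open>Powers of \<open>b\<close> are self-adjoint, so by the C*-identity squaring such
    a power squares its norm.\<close>
  have nk: "norm (b ^ 2 ^ k) = 1" for k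
  proof (induction k)
    case (Suc k)
    have "star (b ^ j) = b ^ j" for j
      by (induction j) (simp_all add: star_mult sa power_commutes)
    then have "norm (b ^ 2 ^ k * b ^ 2 ^ k) = (norm (b ^ 2 ^ k))\<^sup>2"
      using cstar_identity[of "b ^ 2 ^ k"] by simp
    then show ?case using Suc by (simp only: power_Suc mult_2 power_add power_one)
  qed (simp add: nb)
  then have nn: "norm (b ^ n) = 1" by (simp add: n_def)
  obtain G where G: "\<And>z. cmod z \<le> 1 \<Longrightarrow> inverse_pair (1 - z ^ n *\<^sub>C b ^ n) (G z)"
      "\<And>z. cmod z \<le> 1 \<Longrightarrow> norm (G z - G (complex_of_real t * z)) \<le> 1/4"
    using avg[of k0] unfolding n_def by auto
  \<comment> \<open>\<open>v\<close> is within \<open>1/7\<close> of 1 because \<open>h\<close> is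
    small, and \<open>u\<close> is within \<open>1/4\<close> of \<open>v\<close>. But
    \<open>u\<close> inverts \<open>1 - b ^ n\<close>, which bounds the norm of \<open>b ^ n\<close>
    by \<open>2 * norm (u - 1) < 1\<close>.\<close>
  define u v where "u = G 1" and "v = G (complex_of_real t)"
  define h where "h = complex_of_real t ^ n *\<^sub>C b ^ n"
  have h: "norm h \<le> 1/8"
    using tk t by (simp add: h_def norm_scaleC nn[unfolded n_def] norm_power n_def)
  have "inverse_pair (1 - h) v" using G(1)[of "complex_of_real t"] t by (simp add: h_def v_def)
  then have v: "v - 1 = h * v" by (simp add: inverse_pair_def algebra_simps)
  have "norm (v - 1) \<le> norm h * norm v" unfolding v by (rule norm_mult_ineq)
  also have "\<dots> \<le> (1/8) * norm v" using h by (intro mult_right_mono) simp_all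
  also have "norm v \<le> 1 + norm (v - 1)" using norm_triangle_sub[of v 1] by simp
  finally have "norm (v - 1) \<le> 1/7" by simp
  moreover have "norm (u - v) \<le> 1/4" using G(2)[of 1] by (simp add: u_def v_def)
  moreover have "norm (u - 1) \<le> norm (u - v) + norm (v - 1)"
    using norm_triangle_ineq[of "u - v" "v - 1"] by simp
  ultimately have u1: "norm (u - 1) < 1/2" by linarith
  have "inverse_pair (1 - b ^ n) u" using G(1)[of 1] by (simp add: u_def scaleC_one)
  then have "b ^ n = (u - 1) - b ^ n * (u - 1)" by (simp add: inverse_pair_def algebra_simps)
  then have "norm (b ^ n) \<le> norm (u - 1) + norm (b ^ n * (u - 1))"
    using norm_triangle_ineq4 by metis
  also have "norm (b ^ n * (u - 1)) \<le> norm (u - 1)" using norm_mult_ineq[of "b ^ n" "u - 1"] nn by simp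
  finally show False using nn u1 by simp
qed

text \<open>Dividing by the norm reduces to the normalized case, and spectral mapping for a linear
  polynomial carries the point back. This is the source of the norm criterion for
  positivity.\<close>

lemma sp_norm_attained:
  fixes a :: "'a::cstar_algebra_1"
  assumes sa: "star a = a"
  obtains z where "z \<in> sp a" "cmod z = norm a"
proof (cases "a = 0")
  case True
  then show ?thesis using that[of 0] by (simp add: sp_def not_has_inverse_zero)
next
  case False
  define m where "m = norm a"
  have m: "m > 0" using False by (simp add: m_def)
  define b where "b = peval [:0, complex_of_real (1 / m):] a"
  have b: "b = complex_of_real (1 / m) *\<^sub>C a" by (simp add: b_def of_complex_mult_right)
  have "star b = b" "norm b = 1"
    using m sa by (simp_all add: b star_scaleC norm_scaleC norm_divide m_def[symmetric])
  then obtain z where z: "cmod z = 1" "z \<in> sp b" using sp_norm_attained_normalized by blast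
  obtain w where w: "w \<in> sp a" "w * complex_of_real (1 / m) = z"
    using sp_pevalE[OF z(2)[unfolded b_def]] m by auto
  have "cmod w * (1 / m) = 1" using w(2) z(1) m
    by (metis norm_mult norm_of_real abs_of_pos zero_less_divide_1_iff)
  then have "cmod w = m" using m by (simp add: divide_simps split: if_splits)
  with w that show ?thesis by (simp add: m_def)
qed

subsection \<open>Positive elements\<close>

text \<open>The counterpart of \<open>positive\<close> with the spectrum taken in the unital algebra
  itself; \<open>positive_iff_pos\<close> relates the two.\<close>

definition pos :: "'a::cstar_algebra_1 \<Rightarrow> bool"
  where "pos a \<longleftrightarrow> star a = a \<and> sp a \<subseteq> complex_of_real ` {0..}"

lemma pos_star: "pos a \<Longrightarrow> star a = a"
  by (simp add: pos_def)

lemma posI: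
  assumes "star a = a" "\<And>r. complex_of_real r \<in> sp a \<Longrightarrow> 0 \<le> r"
  shows "pos a"
proof -
  have "z \<in> complex_of_real ` {0..}" if "z \<in> sp a" for z
  proof -
    have "z = complex_of_real (Re z)"
      using sp_self_adjoint_real[OF assms(1) that] by (simp add: complex_eq_iff)
    with assms(2)[of "Re z"] that show ?thesis by (metis atLeast_iff imageI)
  qed
  then show ?thesis using assms(1) by (auto simp: pos_def)
qed

lemma posD: "pos a \<Longrightarrow> complex_of_real r \<in> sp a \<Longrightarrow> 0 \<le> r"
  unfolding pos_def by (metis atLeast_iff imageE of_real_eq_iff subsetD)

lemma posE:
  assumes "pos a" "z \<in> sp a"
  obtains r where "0 \<le> r" "z = complex_of_real r"
  using assms unfolding pos_def by auto

lemma star_of_real [simp]: "star (of_real r :: 'a::cstar_algebra_1) = of_real r"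
  by (simp add: of_real_of_complex star_of_complex)

lemma star_scaleR: "star (r *\<^sub>R (a::'a::cstar_algebra)) = r *\<^sub>R star a"
  by (simp add: scaleR_scaleC star_scaleC)

section \<open>Norm criterion for positivity\<close>

lemma sp_of_real_minus: "z \<in> sp (of_real c - a) \<longleftrightarrow> complex_of_real c - z \<in> sp (a::'a::cstar_algebra_1)"
proof -
  have "of_real c - a - of_complex z = - (a - of_complex (complex_of_real c - z))"
    by (simp add: of_real_of_complex of_complex_diff)
  then show ?thesis by (simp only: sp_def mem_Collect_eq has_inverse_minus)
qed

lemma sp_add_of_real: "z \<in> sp (a + of_real c) \<longleftrightarrow> z - complex_of_real c \<in> sp (a::'a::cstar_algebra_1)"
proof -
  have "a + of_real c - of_complex z = a - of_complex (z - complex_of_real c)"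
    by (simp add: of_real_of_complex of_complex_diff)
  then show ?thesis by (simp only: sp_def mem_Collect_eq)
qed

text \<open>The spectrum of \<open>of_real t - a\<close> lies between 0 and \<open>t\<close>, and
  the norm is attained on it.\<close>

lemma pos_norm_le:
  assumes "pos a" "norm a \<le> t"
  shows "norm (of_real t - a) \<le> t"
proof -
  have "star (of_real t - a) = of_real t - a" using assms by (simp add: star_diff pos_star)
  then obtain z where z: "z \<in> sp (of_real t - a)" "cmod z = norm (of_real t - a)"
    by (rule sp_norm_attained)
  then have w: "complex_of_real t - z \<in> sp a" by (simp add: sp_of_real_minus)
  then obtain r where r: "0 \<le> r" "complex_of_real t - z = complex_of_real r"
    using assms(1) posE by blast
  have "r \<le> t" using sp_norm_le[OF w] r assms(2) by simp
  have "z = complex_of_real (t - r)" using r(2) by (simp add: algebra_simps)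
  then have "cmod z = t - r" using \<open>r \<le> t\<close> by (simp only: norm_of_real)
  then show ?thesis using z r by simp
qed

text \<open>A negative spectral value \<open>r\<close> of \<open>a\<close> would put
  \<open>t - r > t\<close> into the spectrum of \<open>of_real t - a\<close>, beyond its
  norm.\<close>

lemma posI_norm:
  assumes "star a = a" "norm (of_real t - a) \<le> t"
  shows "pos a"
proof (rule posI[OF assms(1)])
  fix r assume "complex_of_real r \<in> sp a"
  then have "complex_of_real (t - r) \<in> sp (of_real t - a)" by (simp add: sp_of_real_minus)
  from sp_norm_le[OF this] assms(2) show "0 \<le> r" by (simp only: norm_of_real)
qed

lemma pos_iff_norm: "star a = a \<Longrightarrow> pos a \<longleftrightarrow> norm (of_real (norm a) - a) \<le> norm a"
  using pos_norm_le[of a "norm a"] posI_norm by blast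

text \<open>In terms of the norm criterion this is the triangle inequality.\<close>

lemma pos_add:
  assumes "pos a" "pos b"
  shows "pos (a + b)"
proof (rule posI_norm)
  show "star (a + b) = a + b" using assms by (simp add: star_add pos_star)
  have "norm ((of_real (norm a) - a) + (of_real (norm b) - b)) \<le> norm a + norm b"
    using assms by (intro norm_triangle_mono pos_norm_le) simp_all
  then show "norm (of_real (norm a + norm b) - (a + b)) \<le> norm a + norm b"
    by (simp add: algebra_simps)
qed

lemma pos_scaleR:
  assumes "pos a" "0 \<le> r"
  shows "pos (r *\<^sub>R a)"
proof (rule posI_norm)
  show "star (r *\<^sub>R a) = r *\<^sub>R a" using assms by (simp add: star_scaleR pos_star)
  have "of_real (r * norm a) - r *\<^sub>R a = r *\<^sub>R (of_real (norm a) - a)"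
    by (simp add: algebra_simps of_real_def)
  then show "norm (of_real (r * norm a) - r *\<^sub>R a) \<le> r * norm a"
    using assms pos_norm_le[of a "norm a"] by (simp add: mult_left_mono)
qed

lemma pos_square:
  assumes "star u = u"
  shows "pos (u * u)"
proof (rule posI)
  show "star (u * u) = u * u" using assms by (simp add: star_mult)
  fix r assume "complex_of_real r \<in> sp (u * u)"
  then have "complex_of_real r \<in> sp (peval [:0, 0, 1:] u)" by simp
  then obtain z where z: "z \<in> sp u" "poly [:0, 0, 1:] z = complex_of_real r"
    by (rule sp_pevalE) simp
  have "Im z = 0" using sp_self_adjoint_real[OF assms z(1)] .
  then have "r = Re z * Re z" using z(2) by (simp add: complex_eq_iff)
  then show "0 \<le> r" by simp
qed

lemma pos_uminus_imp_zero:
  assumes "pos a" "pos (- a)"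
  shows "a = 0"
proof -
  obtain z where z: "z \<in> sp a" "cmod z = norm a"
    using sp_norm_attained[of a] assms(1) by (auto simp: pos_star)
  obtain r where r: "0 \<le> r" "z = complex_of_real r" using posE[OF assms(1) z(1)] .
  have "- z \<in> sp (- a)" using z(1) sp_of_real_minus[of "- z" 0 a] by simp
  then have "complex_of_real (- r) \<in> sp (- a)" using r by simp
  from posD[OF assms(2) this] z r show ?thesis by simp
qed

text \<open>If \<open>v\<close> inverts \<open>y * x - z\<close>, then \<open>x * v * y - 1\<close>,
  divided by \<open>z\<close>, inverts \<open>x * y - z\<close>.\<close>

lemma sp_mult_commute:
  fixes x y :: "'a::cstar_algebra_1"
  assumes "z \<in> sp (x * y)" "z \<noteq> 0"
  shows "z \<in> sp (y * x)"
proof (rule ccontr)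
  assume "z \<notin> sp (y * x)"
  then obtain v where v: "(y * x - of_complex z) * v = 1" "v * (y * x - of_complex z) = 1"
    by (auto simp: sp_def has_inverse_def inverse_pair_def)
  have l: "(x * y - of_complex z) * x = x * (y * x - of_complex z)"
    and r: "y * (x * y - of_complex z) = (y * x - of_complex z) * y"
    by (simp_all add: algebra_simps of_complex_mult_left of_complex_mult_right)
  have "(x * y - of_complex z) * (x * v * y - 1) = x * ((y * x - of_complex z) * v) * y - (x * y - of_complex z)"
    by (simp add: right_diff_distrib l flip: mult.assoc)
  then have 1: "(x * y - of_complex z) * (x * v * y - 1) = of_complex z" by (simp add: v)
  have "(x * v * y - 1) * (x * y - of_complex z) = x * (v * (y * x - of_complex z)) * y - (x * y - of_complex z)"
    by (simp add: left_diff_distrib mult.assoc r)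
  then have 2: "(x * v * y - 1) * (x * y - of_complex z) = of_complex z" by (simp add: v)
  have "of_complex (inverse z) * ((x * v * y - 1) * (x * y - of_complex z)) = 1"
    unfolding 2 using assms(2) by (simp flip: of_complex_mult)
  moreover have "((x * y - of_complex z) * (x * v * y - 1)) * of_complex (inverse z) = 1"
    unfolding 1 using assms(2) by (simp flip: of_complex_mult)
  ultimately have "has_inverse (x * y - of_complex z)"
    by (intro has_inverseI[of "of_complex (inverse z) * (x * v * y - 1)" _
          "(x * v * y - 1) * of_complex (inverse z)"]) (simp_all only: mult.assoc)
  then show False using assms(1) by (simp add: sp_def)
qed

text \<open>Up to scaling, \<open>u\<close> and \<open>v\<close> are the real and imaginary parts of
  \<open>x\<close>; the sum of their squares is twice the element in question.\<close>

lemma pos_star_mult_add_mult_star: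
  fixes x :: "'a::cstar_algebra_1"
  shows "pos (star x * x + x * star x)"
proof -
  define u where "u = x + star x"
  define v where "v = \<i> *\<^sub>C (x - star x)"
  have su: "star u = u" by (simp add: u_def star_add star_star add.commute)
  have sv: "star v = v"
    by (simp add: v_def star_scaleC star_diff star_star scaleC_minus_left scaleC_diff_right)
  have "v * v = - ((x - star x) * (x - star x))"
    by (simp add: v_def mult_scaleC_left mult_scaleC_right scaleC_scaleC scaleC_minus_left scaleC_one)
  then have "u * u + v * v = (star x * x + x * star x) + (star x * x + x * star x)"
    by (simp add: u_def algebra_simps)
  also have "\<dots> = 2 *\<^sub>R (star x * x + x * star x)" by (simp add: scaleR_2)
  finally have "(1 / 2) *\<^sub>R (u * u + v * v) = star x * x + x * star x" by simp
  moreover have "pos ((1 / 2) *\<^sub>R (u * u + v * v))"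
    by (intro pos_scaleR pos_add pos_square su sv) simp
  ultimately show ?thesis by simp
qed

text \<open>Kaplansky's argument bounds the negative part of the spectrum of \<open>star x * x\<close> by its positive
  part.  Passing from \<open>x\<close> to \<open>x (m - star x * x)\<close> replaces each point \<open>t\<close> of the spectrum
  by \<open>t (m - t)\<^sup>2\<close>, which shifts the balance towards the negative part; iterating
  this excludes a negative part without any functional calculus.\<close>

lemma sp_star_mult_negative_le:
  fixes x :: "'a::cstar_algebra_1"
  assumes "\<And>r. complex_of_real r \<in> sp (star x * x) \<Longrightarrow> r \<le> m" "0 \<le> m"
    and "complex_of_real (- l) \<in> sp (star x * x)" "0 \<le> l"
  shows "l * 2 ^ n \<le> m"
  using assms
proof (induction n arbitrary: x m l)
  case 0
  \<comment> \<open>The nonzero spectral values of \<open>x * star x\<close> are those of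
    \<open>star x * x\<close>, hence at most \<open>m\<close>. Adding the positive sum of both
    products leaves \<open>star x * x + m\<close>.\<close>
  have "pos (of_real m - x * star x)"
  proof (rule posI)
    show "star (of_real m - x * star x) = of_real m - x * star x"
      by (simp add: star_diff star_mult star_star)
    fix r assume "complex_of_real r \<in> sp (of_real m - x * star x)"
    then have "complex_of_real (m - r) \<in> sp (x * star x)" by (simp add: sp_of_real_minus)
    then have "complex_of_real (m - r) \<in> sp (star x * x)" if "m - r \<noteq> 0"
      using sp_mult_commute that by (metis of_real_eq_0_iff)
    then show "0 \<le> r" using 0(1)[of "m - r"] by (cases "m - r = 0") (use 0(2) in auto)
  qed
  from pos_add[OF this pos_star_mult_add_mult_star[of x]]
  have p: "pos (star x * x + of_real m)" by (simp add: algebra_simps)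
  have "complex_of_real (m - l) \<in> sp (star x * x + of_real m)"
    using 0(3) by (simp add: sp_add_of_real)
  from posD[OF p this] show ?case by simp
next
  case (Suc n)
  define a where "a = star x * x"
  define y where "y = x * (of_real m - a)"
  \<comment> \<open>This is \<open>t (m - t)^2\<close>, with factors ordered as in
    \<open>star y * y\<close>.\<close>
  define f where "f = [:complex_of_real m, -1:] * ([:0, 1:] * [:complex_of_real m, -1:])"
  have sa: "star a = a" by (simp add: a_def star_mult star_star)
  have yy: "star y * y = peval f a"
    unfolding f_def peval_mult
    by (simp add: y_def star_mult star_diff sa of_complex_minus flip: of_real_of_complex a_def)
       (simp add: a_def mult.assoc)
  have val: "poly f (complex_of_real t) = complex_of_real (t * (m - t)\<^sup>2)" for t
    by (simp add: f_def power2_eq_square algebra_simps)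
  have deg: "0 < degree f" by (simp add: f_def degree_mult_eq)
  \<comment> \<open>The spectral bound changes from \<open>m\<close> to \<open>m^3 / 4\<close>,
    while \<open>- l\<close> moves to \<open>- l (m + l)^2\<close>, of size at least
    \<open>l m^2\<close>. Dividing by \<open>m^2\<close> gains a factor 4 where 2 suffices;
    \<open>m = 0\<close> is treated apart.\<close>
  have "(l * (m + l)\<^sup>2) * 2 ^ n \<le> m ^ 3 / 4"
  proof (rule Suc.IH[of y])
    fix r assume "complex_of_real r \<in> sp (star y * y)"
    then obtain z where z: "z \<in> sp a" "poly f z = complex_of_real r"
      unfolding yy using sp_pevalE deg by blast
    obtain t where t: "z = complex_of_real t"
      using sp_self_adjoint_real[OF sa z(1)] by (metis complex_is_Real_iff Reals_cases)
    have tm: "t \<le> m" using Suc.prems(1) z(1) t by (simp add: a_def)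
    have r: "r = t * (m - t)\<^sup>2" using z(2) unfolding t val of_real_eq_iff ..
    show "r \<le> m ^ 3 / 4"
    proof (cases "t \<le> 0")
      case True
      then have "r \<le> 0" unfolding r by (simp add: mult_nonpos_nonneg)
      then show ?thesis using Suc.prems(2) by (meson order_trans zero_le_divide_iff zero_le_numeral zero_le_power)
    next
      case False
      have "t * (m - t) \<le> m\<^sup>2 / 4"
        using zero_le_power2[of "m / 2 - t"] by (simp add: power2_eq_square algebra_simps)
      then have "t * (m - t) * (m - t) \<le> m\<^sup>2 / 4 * m"
        by (rule mult_mono) (use False tm in auto)
      then show ?thesis by (simp add: r power2_eq_square power3_eq_cube mult.assoc)
    qed
  next
    have "poly f (complex_of_real (- l)) \<in> sp (peval f a)"
      using poly_in_sp_peval Suc.prems(3) unfolding a_def by blast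
    then show "complex_of_real (- (l * (m + l)\<^sup>2)) \<in> sp (star y * y)"
      unfolding val yy by simp
  qed (use Suc.prems in auto)
  moreover have "l * m\<^sup>2 * 2 ^ n \<le> (l * (m + l)\<^sup>2) * 2 ^ n"
    using Suc.prems by (intro mult_right_mono mult_left_mono power_mono) simp_all
  ultimately have k: "l * m\<^sup>2 * 2 ^ n \<le> m ^ 3 / 4" by linarith
  show ?case
  proof (cases "m = 0")
    case True
    have "l \<noteq> 0 \<Longrightarrow> (l * (m + l)\<^sup>2) * 2 ^ n > 0" using Suc.prems True by simp
    then show ?thesis
      using \<open>(l * (m + l)\<^sup>2) * 2 ^ n \<le> m ^ 3 / 4\<close> True by (cases "l = 0") auto
  next
    case False
    then have "m > 0" using Suc.prems(2) by simp
    have "m\<^sup>2 * (l * 2 ^ n) \<le> m\<^sup>2 * (m / 4)"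
      using k by (simp add: power2_eq_square power3_eq_cube algebra_simps)
    then have "l * 2 ^ n \<le> m / 4" using \<open>m > 0\<close> by simp
    then show ?thesis using \<open>m > 0\<close> by simp
  qed
qed

text \<open>A negative spectral value \<open>r\<close> would give
  \<open>(- r) * 2 ^ n \<le> norm (star x * x)\<close> for every \<open>n\<close>.\<close>

lemma pos_star_mult: "pos (star x * (x::'a::cstar_algebra_1))"
proof (rule posI)
  show "star (star x * x) = star x * x" by (simp add: star_mult star_star)
  fix r assume r: "complex_of_real r \<in> sp (star x * x)"
  show "0 \<le> r"
  proof (rule ccontr)
    assume neg: "\<not> 0 \<le> r"
    define m where "m = norm (star x * x)"
    have "(- r) * 2 ^ n \<le> m" for n
    proof (rule sp_star_mult_negative_le[of x])
      fix t assume "complex_of_real t \<in> sp (star x * x)"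
      from sp_norm_le[OF this] show "t \<le> m" by (simp add: m_def)
    qed (use r neg in \<open>simp_all add: m_def\<close>)
    moreover obtain n where "m / (- r) < 2 ^ n" using real_arch_pow[of 2] by auto
    then have "m < (- r) * 2 ^ n" using neg by (simp add: field_simps)
    ultimately show False by (meson not_le)
  qed
qed

text \<open>Invertibility keeps the spectrum of \<open>a\<close> at distance \<open>d\<close> from
  0, so \<open>a - d\<close> is still positive; the amount \<open>d\<close> absorbs the perturbation
  \<open>b - a\<close>.\<close>

lemma pos_perturb:
  fixes a :: "'a::cstar_algebra_1"
  assumes "pos a" "has_inverse a"
  obtains d where "d > 0" "\<And>b. star b = b \<Longrightarrow> norm (b - a) \<le> d \<Longrightarrow> pos b"
proof -
  obtain v where v: "inverse_pair a v" using assms(2) by (auto simp: has_inverse_def)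
  define d where "d = 1 / (norm v + 1)"
  have "0 < norm v + 1" by (simp add: add_nonneg_pos)
  then have d: "d > 0" "d * norm v < 1" by (simp_all add: d_def)
  have pd: "pos (a - of_real d)"
  proof (rule posI)
    show "star (a - of_real d) = a - of_real d" using assms(1) by (simp add: star_diff pos_star)
    fix r assume "complex_of_real r \<in> sp (a - of_real d)"
    then have s: "complex_of_real (r + d) \<in> sp a"
      using sp_add_of_real[of "complex_of_real r" a "- d"] by simp
    then have "0 \<le> r + d" using assms(1) posD by blast
    show "0 \<le> r"
    proof (rule ccontr)
      assume "\<not> 0 \<le> r"
      then have "\<bar>r + d\<bar> * norm v \<le> d * norm v" using \<open>0 \<le> r + d\<close> by (intro mult_right_mono) auto
      also have "\<dots> < 1" by (fact d)
      finally have "has_inverse (a - of_complex (complex_of_real (r + d)))"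
        by (intro has_inverse_perturb[OF v]) (simp del: of_real_add)
      then show False using s by (simp add: sp_def)
    qed
  qed
  have "pos b" if b: "star b = b" "norm (b - a) \<le> d" for b
  proof -
    have "pos (of_real d + (b - a))"
      by (rule posI_norm[of _ d]) (use b assms(1) in \<open>simp_all add: star_add star_diff pos_star norm_minus_commute\<close>)
    from pos_add[OF pd this] show ?thesis by simp
  qed
  with d(1) show ?thesis by (rule that)
qed

text \<open>Positivity is closed along the path, since the norm criterion reads
  \<open>g t \<le> 0\<close> with \<open>g\<close> continuous, and open for \<open>t > 0\<close> by
  \<open>pos_perturb\<close>. Connectedness spreads it from \<open>T\<close> to all
  \<open>t > 0\<close>, and continuity of \<open>g\<close> reaches 0, where invertibility may
  fail.\<close>

lemma pos_path:
  fixes f :: "real \<Rightarrow> 'a::cstar_algebra_1"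
  assumes cont: "continuous_on {0..T} f" and T: "0 < T"
    and sa: "\<And>t. star (f t) = f t"
    and inv: "\<And>t. 0 < t \<Longrightarrow> t \<le> T \<Longrightarrow> has_inverse (f t)"
    and pT: "pos (f T)"
  shows "pos (f 0)"
proof -
  define g where "g t = norm (of_real (norm (f t)) - f t) - norm (f t)" for t
  have pos_iff: "pos (f t) \<longleftrightarrow> g t \<le> 0" for t
    using pos_iff_norm[OF sa[of t]] by (simp add: g_def)
  have g: "continuous_on {0..T} g"
    unfolding g_def by (intro continuous_intros cont)
  let ?S = "{0<..T}"
  define E where "E = {t \<in> ?S. pos (f t)}"
  have "closedin (top_of_set ?S) (?S \<inter> g -` {..0})"
    by (rule continuous_closedin_preimage) (auto intro: continuous_on_subset[OF g])
  moreover have "?S \<inter> g -` {..0} = E" by (auto simp: E_def pos_iff)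
  ultimately have "closedin (top_of_set ?S) E" by simp
  moreover have "openin (top_of_set ?S) E"
    unfolding openin_euclidean_subtopology_iff
  proof (intro conjI ballI)
    fix t assume t: "t \<in> E"
    obtain d where d: "d > 0" "\<And>b. star b = b \<Longrightarrow> norm (b - f t) \<le> d \<Longrightarrow> pos b"
      using pos_perturb[of "f t"] t inv by (auto simp: E_def)
    obtain e where e: "e > 0" "\<And>s. s \<in> {0..T} \<Longrightarrow> dist s t < e \<Longrightarrow> dist (f s) (f t) < d"
      using cont t d(1) unfolding continuous_on_iff E_def by fastforce
    have "s \<in> E" if "s \<in> ?S" "dist s t < e" for s
      using that d(2)[OF sa[of s]] e(2)[of s] by (auto simp: E_def dist_norm intro: less_imp_le)
    then show "\<exists>e>0. \<forall>s\<in>?S. dist s t < e \<longrightarrow> s \<in> E" using e(1) by blast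
  qed (auto simp: E_def)
  moreover have "connected ?S" by simp
  moreover have "T \<in> E" using pT T by (simp add: E_def)
  ultimately have "E = ?S" unfolding connected_clopen by blast
  then have le: "g t \<le> 0" if "t \<in> ?S" for t
  proof -
    have "t \<in> E" using that \<open>E = ?S\<close> by simp
    then show ?thesis by (simp add: E_def pos_iff)
  qed
  have cl: "closure ?S = {0..T}" using T by (rule closure_greaterThanAtMost)
  have "g 0 \<le> 0"
    by (rule continuous_le_on_closure[of ?S g]) (use g le T in \<open>auto simp: cl\<close>)
  then show ?thesis by (simp add: pos_iff)
qed

subsection \<open>The unitization\<close>

text \<open>\<open>Adjoin a s\<close> stands for \<open>a + s 1\<close>.  Its norm is the maximum of the operator norm of left
  multiplication on \<open>A\<close> and \<open>|s|\<close>; the second term is needed only when \<open>A\<close> already has a unit, as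
  left multiplication is then not faithful.\<close>

datatype 'a unitization = Adjoin (alg_part: 'a) (scalar_part: complex)

instantiation unitization :: (complex_star_algebra) complex_star_algebra
begin

definition zero_unitization :: "'a unitization" where "0 = Adjoin 0 0"

definition plus_unitization :: "'a unitization \<Rightarrow> 'a unitization \<Rightarrow> 'a unitization"
  where "u + v = Adjoin (alg_part u + alg_part v) (scalar_part u + scalar_part v)"

definition minus_unitization :: "'a unitization \<Rightarrow> 'a unitization \<Rightarrow> 'a unitization"
  where "u - v = Adjoin (alg_part u - alg_part v) (scalar_part u - scalar_part v)"

definition uminus_unitization :: "'a unitization \<Rightarrow> 'a unitization"
  where "- u = Adjoin (- alg_part u) (- scalar_part u)"

definition times_unitization :: "'a unitization \<Rightarrow> 'a unitization \<Rightarrow> 'a unitization"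
  where "u * v = Adjoin
    (alg_part u * alg_part v + scalar_part v *\<^sub>C alg_part u + scalar_part u *\<^sub>C alg_part v)
    (scalar_part u * scalar_part v)"

definition scaleC_unitization :: "complex \<Rightarrow> 'a unitization \<Rightarrow> 'a unitization"
  where "c *\<^sub>C u = Adjoin (c *\<^sub>C alg_part u) (c * scalar_part u)"

definition star_unitization :: "'a unitization \<Rightarrow> 'a unitization"
  where "star u = Adjoin (star (alg_part u)) (cnj (scalar_part u))"

instance
  by standard
    (simp_all add: zero_unitization_def plus_unitization_def minus_unitization_def
      uminus_unitization_def times_unitization_def scaleC_unitization_def star_unitization_def
      unitization.expand algebra_simps scaleC_add_right scaleC_add_left scaleC_scaleC scaleC_one
      mult_scaleC_left mult_scaleC_right star_star star_add star_scaleC star_mult)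

end

lemmas unitization_defs = zero_unitization_def plus_unitization_def minus_unitization_def
  uminus_unitization_def times_unitization_def scaleC_unitization_def star_unitization_def

instantiation unitization :: (complex_star_algebra) ring_1
begin

definition one_unitization :: "'a unitization" where "1 = Adjoin 0 1"

instance
  by standard (simp_all add: one_unitization_def unitization_defs scaleC_one)

end

section \<open>The operator norm of left multiplication\<close>

definition left_mult :: "'a::cstar_algebra unitization \<Rightarrow> 'a \<Rightarrow> 'a"
  where "left_mult u b = alg_part u * b + scalar_part u *\<^sub>C b"

lemma left_mult_add: "left_mult (u + v) b = left_mult u b + left_mult v b"
  by (simp add: left_mult_def unitization_defs algebra_simps scaleC_add_left)

lemma left_mult_mult: "left_mult (u * v) b = left_mult u (left_mult v b)"
  by (simp add: left_mult_def unitization_defs algebra_simps scaleC_add_right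
      scaleC_scaleC mult_scaleC_left mult_scaleC_right)

lemma left_mult_scaleC: "left_mult (c *\<^sub>C u) b = c *\<^sub>C left_mult u b"
  by (simp add: left_mult_def unitization_defs scaleC_add_right scaleC_scaleC mult_scaleC_left)

lemma scaleC_scaleR_commute: "c *\<^sub>C r *\<^sub>R (b::'a::cstar_algebra) = r *\<^sub>R c *\<^sub>C b"
  by (simp add: scaleR_scaleC scaleC_scaleC mult.commute)

lemma bounded_linear_scaleC: "bounded_linear ((*\<^sub>C) c :: 'a::cstar_algebra \<Rightarrow> 'a)"
  by (rule bounded_linear_intro[where K = "cmod c"])
    (simp_all add: scaleC_add_right scaleC_scaleR_commute norm_scaleC)

lemma bounded_linear_left_mult: "bounded_linear (left_mult u)"
  unfolding left_mult_def
  by (intro bounded_linear_add bounded_linear_mult_right bounded_linear_scaleC)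

definition op_norm :: "'a::cstar_algebra unitization \<Rightarrow> real"
  where "op_norm u = onorm (left_mult u)"

lemma norm_left_mult_le: "norm (left_mult u b) \<le> op_norm u * norm b"
  unfolding op_norm_def by (rule onorm[OF bounded_linear_left_mult])

lemma op_norm_nonneg: "0 \<le> op_norm u"
  unfolding op_norm_def by (rule onorm_pos_le[OF bounded_linear_left_mult])

lemma op_norm_add: "op_norm (u + v) \<le> op_norm u + op_norm v"
  using onorm_triangle[OF bounded_linear_left_mult bounded_linear_left_mult, of u v]
  by (simp add: op_norm_def left_mult_add[abs_def])

lemma op_norm_mult: "op_norm (u * v) \<le> op_norm u * op_norm v"
  using onorm_compose[OF bounded_linear_left_mult bounded_linear_left_mult, of u v]
  by (simp add: op_norm_def left_mult_mult[abs_def] comp_def)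

lemma op_norm_scaleC: "op_norm (c *\<^sub>C u) = cmod c * op_norm u"
proof -
  have le: "op_norm (c *\<^sub>C u) \<le> cmod c * op_norm u" for c and u :: "'a unitization"
    unfolding op_norm_def left_mult_scaleC
    by (rule onorm_bound) (simp_all add: left_mult_scaleC norm_scaleC mult.assoc mult_left_mono
        norm_left_mult_le[unfolded op_norm_def] op_norm_nonneg[unfolded op_norm_def])
  show ?thesis
  proof (cases "c = 0")
    case True
    then show ?thesis using le[of c u] op_norm_nonneg[of "c *\<^sub>C u"] by simp
  next
    case False
    have "cmod c * op_norm u = cmod c * op_norm (inverse c *\<^sub>C c *\<^sub>C u)"
      using False by (simp add: scaleC_scaleC scaleC_one)
    also have "\<dots> \<le> cmod c * (cmod (inverse c) * op_norm (c *\<^sub>C u))"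
      by (intro mult_left_mono le) simp
    also have "\<dots> = op_norm (c *\<^sub>C u)" using False by (simp add: norm_inverse)
    finally show ?thesis using le[of c u] by simp
  qed
qed

lemma op_norm_le: "op_norm u \<le> norm (alg_part u) + cmod (scalar_part u)"
  unfolding op_norm_def
proof (rule onorm_bound)
  fix b :: 'a
  have "norm (left_mult u b) \<le> norm (alg_part u) * norm b + cmod (scalar_part u) * norm b"
    unfolding left_mult_def by (intro norm_triangle_mono norm_mult_ineq) (simp add: norm_scaleC)
  then show "norm (left_mult u b) \<le> (norm (alg_part u) + cmod (scalar_part u)) * norm b"
    by (simp add: distrib_right)
qed simp

text \<open>Testing left multiplication on the adjoint of the algebra part recovers its norm. This
  yields definiteness and completeness of the norm on the unitization.\<close>

lemma norm_alg_part_le: "norm (alg_part u) \<le> op_norm u + cmod (scalar_part u)"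
proof (cases "alg_part u = 0")
  case False
  let ?a = "alg_part u"
  have "norm ?a * norm ?a = norm (left_mult u (star ?a) - scalar_part u *\<^sub>C star ?a)"
    by (simp add: left_mult_def cstar_identity' power2_eq_square)
  also have "\<dots> \<le> norm (left_mult u (star ?a)) + norm (scalar_part u *\<^sub>C star ?a)"
    by (rule norm_triangle_ineq4)
  also have "\<dots> \<le> op_norm u * norm ?a + cmod (scalar_part u) * norm ?a"
    using norm_left_mult_le[of u "star ?a"] by (simp add: norm_scaleC)
  finally show ?thesis using False by (simp flip: distrib_right)
qed (simp add: op_norm_nonneg)

text \<open>\<open>left_mult (star u)\<close> is the adjoint of \<open>left_mult u\<close> for the
  algebra-valued inner product \<open>star b * c\<close>.\<close>

lemma star_left_mult: "star (left_mult u b) * c = star b * left_mult (star u) c"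
  by (simp add: left_mult_def unitization_defs star_add star_mult star_scaleC algebra_simps
      mult_scaleC_left mult_scaleC_right)

text \<open>As for operators on a Hilbert space: move one factor across the algebra-valued inner
  product, using the C*-identity for \<open>left_mult u b\<close>.\<close>

lemma op_norm_square_le: "(op_norm u)\<^sup>2 \<le> op_norm (star u * u)"
proof -
  have "op_norm u \<le> sqrt (op_norm (star u * u))"
    unfolding op_norm_def[of u]
  proof (rule onorm_bound)
    fix b :: 'a
    have "(norm (left_mult u b))\<^sup>2 = norm (star b * left_mult (star u * u) b)"
      by (simp flip: cstar_identity add: star_left_mult left_mult_mult)
    also have "\<dots> \<le> norm b * (op_norm (star u * u) * norm b)"
      by (rule order_trans[OF norm_mult_ineq]) (simp add: mult_left_mono norm_left_mult_le)
    also have "\<dots> = (sqrt (op_norm (star u * u)) * norm b)\<^sup>2"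
      by (simp add: power_mult_distrib op_norm_nonneg power2_eq_square)
    finally show "norm (left_mult u b) \<le> sqrt (op_norm (star u * u)) * norm b"
      by (rule power2_le_imp_le) (simp add: op_norm_nonneg)
  qed (simp add: op_norm_nonneg)
  then have "(op_norm u)\<^sup>2 \<le> (sqrt (op_norm (star u * u)))\<^sup>2"
    by (rule power_mono) (rule op_norm_nonneg)
  then show ?thesis by (simp add: op_norm_nonneg)
qed

lemma op_norm_star: "op_norm (star u) = op_norm u"
proof -
  have le: "op_norm u \<le> op_norm (star u)" for u :: "'a unitization"
  proof (cases "op_norm u = 0")
    case False
    have "op_norm u * op_norm u \<le> op_norm (star u) * op_norm u"
      using order_trans[OF op_norm_square_le op_norm_mult] by (simp add: power2_eq_square)
    then show ?thesis using False op_norm_nonneg[of u] by simp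
  qed (simp add: op_norm_nonneg)
  from le[of u] le[of "star u"] show ?thesis by (simp add: star_star)
qed

lemma op_norm_cstar: "op_norm (star u * u) = (op_norm u)\<^sup>2"
  using op_norm_square_le[of u] op_norm_mult[of "star u" u]
  by (simp add: op_norm_star power2_eq_square)

instantiation unitization :: (complex_star_algebra) real_vector
begin

definition scaleR_unitization
  where "scaleR r (u :: 'a unitization) = complex_of_real r *\<^sub>C u"

instance
  by standard
    (simp_all add: scaleR_unitization_def scaleC_add_right scaleC_add_left scaleC_scaleC scaleC_one)

end

instantiation unitization :: (cstar_algebra) real_normed_vector
begin

definition norm_unitization :: "'a unitization \<Rightarrow> real"
  where "norm u = max (op_norm u) (cmod (scalar_part u))"

definition dist_unitization
  where "dist u (v :: 'a unitization) = norm (u - v)"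

definition sgn_unitization
  where "sgn (u :: 'a unitization) = inverse (norm u) *\<^sub>R u"

definition uniformity_unitization
  where "(uniformity :: ('a unitization \<times> 'a unitization) filter) = (INF e\<in>{0<..}. principal {(u, v). dist u v < e})"

definition open_unitization
  where "open (U :: 'a unitization set) = (\<forall>u\<in>U. eventually (\<lambda>(u', v). u' = u \<longrightarrow> v \<in> U) uniformity)"

instance
proof
  fix u v :: "'a unitization" and r s :: real
  show "norm u = 0 \<longleftrightarrow> u = 0"
  proof
    assume "norm u = 0"
    then have s: "op_norm u = 0" "scalar_part u = 0"
      using op_norm_nonneg[of u] by (auto simp: norm_unitization_def max_def split: if_splits)
    then have "alg_part u = 0" using norm_alg_part_le[of u] by simp
    with s show "u = 0" by (simp add: zero_unitization_def unitization.expand)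
  next
    assume "u = 0"
    then show "norm u = 0"
      using op_norm_le[of u] op_norm_nonneg[of u]
      by (simp add: norm_unitization_def zero_unitization_def)
  qed
  have "scalar_part (u + v) = scalar_part u + scalar_part v" by (simp add: plus_unitization_def)
  then show "norm (u + v) \<le> norm u + norm v"
    using op_norm_add[of u v] norm_triangle_ineq[of "scalar_part u" "scalar_part v"]
    by (auto simp: norm_unitization_def max_def)
  show "norm (r *\<^sub>R u) = \<bar>r\<bar> * norm u"
    by (simp add: norm_unitization_def scaleR_unitization_def op_norm_scaleC max_mult_distrib_left)
      (simp add: scaleC_unitization_def norm_mult)
qed (simp_all add: dist_unitization_def sgn_unitization_def uniformity_unitization_def open_unitization_def)

end

instance unitization :: (cstar_algebra) real_normed_algebra_1
proof
  fix u v :: "'a unitization" and r :: real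
  show "r *\<^sub>R u * v = r *\<^sub>R (u * v)" "u * r *\<^sub>R v = r *\<^sub>R (u * v)"
    by (simp_all add: scaleR_unitization_def mult_scaleC_left mult_scaleC_right)
  have "scalar_part (u * v) = scalar_part u * scalar_part v" by (simp add: times_unitization_def)
  then show "norm (u * v) \<le> norm u * norm v"
    using mult_mono[of "op_norm u" "norm u" "op_norm v" "norm v"]
      mult_mono[of "cmod (scalar_part u)" "norm u" "cmod (scalar_part v)" "norm v"]
      order_trans[OF op_norm_mult[of u v]]
    by (simp add: norm_unitization_def op_norm_nonneg norm_mult le_max_iff_disj)
  show "norm (1::'a unitization) = 1"
    using op_norm_le[of "1::'a unitization"]
    by (simp add: norm_unitization_def one_unitization_def)
qed

instance unitization :: (cstar_algebra) banach
proof
  fix X :: "nat \<Rightarrow> 'a unitization"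
  assume X: "Cauchy X"
  have d: "alg_part (X m) - alg_part (X n) = alg_part (X m - X n)"
    "scalar_part (X m) - scalar_part (X n) = scalar_part (X m - X n)" for m n
    by (simp_all add: minus_unitization_def)
  have s: "cmod (scalar_part u) \<le> norm u" for u :: "'a unitization"
    by (simp add: norm_unitization_def)
  \<comment> \<open>With \<open>s\<close>, this makes both components of a Cauchy sequence
    Cauchy.\<close>
  have a: "norm (alg_part u) \<le> 2 * norm u" for u :: "'a unitization"
    using norm_alg_part_le[of u] by (simp add: norm_unitization_def)
  have "Cauchy (\<lambda>n. scalar_part (X n))"
  proof (rule CauchyI)
    fix e :: real assume "0 < e"
    then obtain M where "\<forall>m\<ge>M. \<forall>n\<ge>M. norm (X m - X n) < e" using CauchyD[OF X] by blast
    then show "\<exists>M. \<forall>m\<ge>M. \<forall>n\<ge>M. norm (scalar_part (X m) - scalar_part (X n)) < e"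
      unfolding d using s le_less_trans by blast
  qed
  then obtain t where t: "(\<lambda>n. scalar_part (X n)) \<longlonglongrightarrow> t" using Cauchy_convergent convergentD by blast
  have "Cauchy (\<lambda>n. alg_part (X n))"
  proof (rule CauchyI)
    fix e :: real assume "0 < e"
    then obtain M where "\<forall>m\<ge>M. \<forall>n\<ge>M. norm (X m - X n) < e / 2" using CauchyD[OF X, of "e / 2"] by auto
    then have "\<forall>m\<ge>M. \<forall>n\<ge>M. 2 * norm (X m - X n) < e" by (simp add: mult.commute)
    then show "\<exists>M. \<forall>m\<ge>M. \<forall>n\<ge>M. norm (alg_part (X m) - alg_part (X n)) < e"
      unfolding d using a le_less_trans by blast
  qed
  then obtain b where b: "(\<lambda>n. alg_part (X n)) \<longlonglongrightarrow> b" using Cauchy_convergent convergentD by blast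
  have lim: "(\<lambda>n. norm (alg_part (X n) - b) + cmod (scalar_part (X n) - t)) \<longlonglongrightarrow> 0"
    using tendsto_add[OF tendsto_norm_zero[OF LIM_zero[OF b]] tendsto_norm_zero[OF LIM_zero[OF t]]] by simp
  have "\<forall>n. norm (X n - Adjoin b t) \<le> norm (alg_part (X n) - b) + cmod (scalar_part (X n) - t)"
    using op_norm_le[of "X _ - Adjoin b t"] by (simp add: norm_unitization_def minus_unitization_def)
  from Lim_null_comparison[OF always_eventually[OF this] lim]
  have "(\<lambda>n. X n - Adjoin b t) \<longlonglongrightarrow> 0" .
  then show "convergent X" using LIM_zero_cancel convergentI by blast
qed

instance unitization :: (cstar_algebra) cstar_algebra_1
proof
  fix u :: "'a unitization" and c :: complex and r :: real
  show "r *\<^sub>R u = complex_of_real r *\<^sub>C u" by (fact scaleR_unitization_def)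
  show "norm (c *\<^sub>C u) = cmod c * norm u"
    by (simp add: norm_unitization_def op_norm_scaleC max_mult_distrib_left)
      (simp add: scaleC_unitization_def norm_mult)
  have "scalar_part (star u * u) = cnj (scalar_part u) * scalar_part u"
    by (simp add: unitization_defs)
  then show "norm (star u * u) = (norm u)\<^sup>2"
    using op_norm_nonneg[of u]
    by (auto simp: norm_unitization_def op_norm_cstar norm_mult max_def power2_eq_square[symmetric]
        power_mono_iff)
qed

subsection \<open>Two by two matrices\<close>

definition unitize :: "'a::cstar_algebra \<Rightarrow> 'a unitization"
  where "unitize a = Adjoin a 0"

lemma unitize_add: "unitize (a + b) = unitize a + unitize b"
  and unitize_diff: "unitize (a - b) = unitize a - unitize b"
  and unitize_mult: "unitize (a * b) = unitize a * unitize b"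
  and unitize_scaleR: "unitize (r *\<^sub>R a) = r *\<^sub>R unitize a"
  and unitize_star: "unitize (star a) = star (unitize a)"
  and unitize_eq_iff [simp]: "unitize a = unitize b \<longleftrightarrow> a = b"
  by (simp_all add: unitize_def unitization_defs scaleR_unitization_def scaleR_scaleC)

lemma norm_unitize [simp]: "norm (unitize a) = norm a"
  using op_norm_le[of "unitize a"] norm_alg_part_le[of "unitize a"] op_norm_nonneg[of "unitize a"]
  by (simp add: norm_unitization_def unitize_def)

lemma of_complex_unitization: "of_complex z = Adjoin 0 z"
  by (simp add: of_complex_def one_unitization_def scaleC_unitization_def)

lemma unitization_invertible_iff: "unitization_invertible (a, s) \<longleftrightarrow> has_inverse (Adjoin a s)"
proof -
  have "(\<exists>v. P v) \<longleftrightarrow> (\<exists>b t. P (Adjoin b t))" for P :: "'a unitization \<Rightarrow> bool"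
    by (metis unitization.exhaust)
  then show ?thesis
    by (simp add: unitization_invertible_def has_inverse_def inverse_pair_def unitization_mult_def
        times_unitization_def one_unitization_def)
qed

lemma spectrum_eq_sp: "spectrum a = sp (unitize a)"
  by (simp add: spectrum_def sp_def unitization_invertible_iff of_complex_unitization unitize_def
      minus_unitization_def)

lemma positive_iff_pos: "positive a \<longleftrightarrow> pos (unitize a)"
  by (simp add: positive_def pos_def spectrum_eq_sp flip: unitize_star)

text \<open>The identity matrix is written out because \<open>mat2\<close> carries only the
  structure of a possibly nonunital algebra.\<close>

definition inv2 :: "'a::{complex_star_algebra,ring_1} mat2 \<Rightarrow> bool"
  where "inv2 M \<longleftrightarrow> (\<exists>N. M * N = Mat2 1 0 0 1 \<and> N * M = Mat2 1 0 0 1)"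

lemma ex_mat2: "(\<exists>N. P N) \<longleftrightarrow> (\<exists>a b c d. P (Mat2 a b c d))"
  by (metis mat2.exhaust)

text \<open>The unitization of the matrix algebra sits inside the matrices over the unitization as
  those whose scalar parts form a multiple of the identity. The scalar parts of an inverse must
  invert \<open>- z\<close> times the identity, so the inverse has this form too.\<close>

lemma spectrum_mat2_iff:
  "z \<notin> spectrum (Mat2 a b c d) \<longleftrightarrow> z \<noteq> 0 \<and>
    inv2 (Mat2 (unitize a - of_complex z) (unitize b) (unitize c) (unitize d - of_complex z))"
    (is "?L \<longleftrightarrow> z \<noteq> 0 \<and> inv2 ?U")
proof
  assume ?L
  then obtain N s where N: "unitization_mult (Mat2 a b c d, - z) (N, s) = (0, 1)"
    "unitization_mult (N, s) (Mat2 a b c d, - z) = (0, 1)"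
    by (auto simp: spectrum_def unitization_invertible_def)
  obtain e f g h where "N = Mat2 e f g h" by (rule mat2.exhaust)
  with N have "?U * Mat2 (Adjoin e s) (Adjoin f 0) (Adjoin g 0) (Adjoin h s) = Mat2 1 0 0 1"
    "Mat2 (Adjoin e s) (Adjoin f 0) (Adjoin g 0) (Adjoin h s) * ?U = Mat2 1 0 0 1"
    by (simp_all add: unitization_mult_def times_mat2_def plus_mat2_def scaleC_mat2_def zero_mat2_def
        unitization_defs one_unitization_def unitize_def of_complex_unitization algebra_simps)
  moreover have "z \<noteq> 0" using N by (auto simp: unitization_mult_def)
  ultimately show "z \<noteq> 0 \<and> inv2 ?U" by (auto simp: inv2_def)
next
  assume "z \<noteq> 0 \<and> inv2 ?U"
  then have z: "z \<noteq> 0" and "inv2 ?U" by auto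
  then obtain N where N: "?U * N = Mat2 1 0 0 1" "N * ?U = Mat2 1 0 0 1"
    by (auto simp: inv2_def)
  obtain e' f' g' h' where N': "N = Mat2 e' f' g' h'" by (rule mat2.exhaust)
  obtain e s where e: "e' = Adjoin e s" by (rule unitization.exhaust)
  obtain f t where f: "f' = Adjoin f t" by (rule unitization.exhaust)
  obtain g u where g: "g' = Adjoin g u" by (rule unitization.exhaust)
  obtain h v where h: "h' = Adjoin h v" by (rule unitization.exhaust)
  have "- z * s = 1" "- z * t = 0" "- z * u = 0" "- z * v = 1"
    using N(1) by (simp_all add: N' e f g h times_mat2_def unitization_defs one_unitization_def
        unitize_def of_complex_unitization)
  then have st: "t = 0" "u = 0" "v = s" "- z * s = 1" using z
    by (simp_all, metis minus_mult_left mult_cancel_left neg_equal_iff_equal)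
  have "unitization_mult (Mat2 a b c d, - z) (Mat2 e f g h, s) = (0, 1)"
    "unitization_mult (Mat2 e f g h, s) (Mat2 a b c d, - z) = (0, 1)"
    using N st(4) by (simp_all add: N' e f g h st(1-3) unitization_mult_def times_mat2_def plus_mat2_def
        scaleC_mat2_def zero_mat2_def
        unitization_defs one_unitization_def unitize_def of_complex_unitization algebra_simps)
  then show ?L by (auto simp: spectrum_def unitization_invertible_def)
qed

text \<open>Block elimination: the equations for \<open>f\<close> and \<open>g\<close> are solved in
  terms of \<open>h\<close>, the lower right entry of the inverse, and \<open>h\<close> then inverts
  the Schur complement.\<close>

lemma inv2_schur:
  assumes "inv2 (Mat2 a b c d)" "inverse_pair a a'"
  shows "has_inverse (d - c * a' * b)"
proof -
  obtain e f g h where N: "Mat2 a b c d * Mat2 e f g h = Mat2 1 0 0 1"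
    "Mat2 e f g h * Mat2 a b c d = Mat2 1 0 0 1"
    using assms(1) unfolding inv2_def ex_mat2 by auto
  have r: "a * f + b * h = 0" "c * f + d * h = 1" and l: "g * a + h * c = 0" "g * b + h * d = 1"
    using N by (simp_all add: times_mat2_def)
  have "a' * (a * f + b * h) = 0" "(g * a + h * c) * a' = 0" by (simp_all only: r l mult_zero_right mult_zero_left)
  moreover have "a' * (a * f) = f" "(g * a) * a' = g"
    using assms(2) by (simp_all add: inverse_pair_def mult.assoc) (simp flip: mult.assoc)
  ultimately have f: "f = - (a' * b * h)" and g: "g = - (h * c * a')"
    by (simp_all add: distrib_left distrib_right eq_neg_iff_add_eq_0 mult.assoc)
  show ?thesis
  proof (rule has_inverseI)
    show "h * (d - c * a' * b) = 1" using l(2) by (simp add: g algebra_simps)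
    show "(d - c * a' * b) * h = 1" using r(2) by (simp add: f algebra_simps)
  qed
qed

text \<open>Conjugation by the flip. With equal diagonal entries it exchanges \<open>x\<close> and
  \<open>star x\<close>, so that absorption on the right follows from absorption on the
  left.\<close>

lemma inv2_swap: "inv2 (Mat2 a b c d) \<Longrightarrow> inv2 (Mat2 d c b a)"
proof -
  assume "inv2 (Mat2 a b c d)"
  then obtain e f g h where N: "Mat2 a b c d * Mat2 e f g h = Mat2 1 0 0 1"
    "Mat2 e f g h * Mat2 a b c d = Mat2 1 0 0 1"
    unfolding inv2_def ex_mat2 by auto
  then show ?thesis
    unfolding inv2_def by (intro exI[of _ "Mat2 h g f e"]) (simp add: times_mat2_def add.commute)
qed

text \<open>Conjugation by the Hadamard unitary gives the diagonal matrix with entries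
  \<open>a + b\<close> and \<open>a - b\<close>.\<close>

lemma inv2_symmetric_iff:
  fixes a b :: "'a::cstar_algebra_1"
  shows "inv2 (Mat2 a b b a) \<longleftrightarrow> has_inverse (a + b) \<and> has_inverse (a - b)"
proof
  assume "inv2 (Mat2 a b b a)"
  then obtain e f g h where N: "Mat2 a b b a * Mat2 e f g h = Mat2 1 0 0 1"
    "Mat2 e f g h * Mat2 a b b a = Mat2 1 0 0 1"
    unfolding inv2_def ex_mat2 by auto
  have n: "a * e + b * g = 1" "b * e + a * g = 0" "e * a + f * b = 1" "e * b + f * a = 0"
    using N by (simp_all add: times_mat2_def)
  have "(e + f) * (a + b) = (e * a + f * b) + (e * b + f * a)"
    "(a + b) * (e + g) = (a * e + b * g) + (b * e + a * g)"
    "(e - f) * (a - b) = (e * a + f * b) - (e * b + f * a)"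
    "(a - b) * (e - g) = (a * e + b * g) - (b * e + a * g)"
    by (simp_all add: algebra_simps)
  then have "(e + f) * (a + b) = 1" "(a + b) * (e + g) = 1" "(e - f) * (a - b) = 1" "(a - b) * (e - g) = 1"
    by (simp_all only: n) simp_all
  then show "has_inverse (a + b) \<and> has_inverse (a - b)" using has_inverseI by blast
next
  assume "has_inverse (a + b) \<and> has_inverse (a - b)"
  then obtain u v where u: "inverse_pair (a + b) u" and v: "inverse_pair (a - b) v"
    by (auto simp: has_inverse_def)
  have half: "(1 / 2) *\<^sub>R (2::'a) = 1" by (metis scaleR_half_double one_add_one)
  have "a * (u + v) + b * (u - v) = (a + b) * u + (a - b) * v"
    "a * (u - v) + b * (u + v) = (a + b) * u - (a - b) * v"
    "(u + v) * a + (u - v) * b = u * (a + b) + v * (a - b)"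
    "(u - v) * a + (u + v) * b = u * (a + b) - v * (a - b)"
    by (simp_all add: algebra_simps)
  then have "a * (u + v) + b * (u - v) = 2" "a * (u - v) + b * (u + v) = 0"
    "(u + v) * a + (u - v) * b = 2" "(u - v) * a + (u + v) * b = 0"
    using u v by (simp_all add: inverse_pair_def)
  then have "Mat2 a b b a * Mat2 ((1 / 2) *\<^sub>R (u + v)) ((1 / 2) *\<^sub>R (u - v)) ((1 / 2) *\<^sub>R (u - v)) ((1 / 2) *\<^sub>R (u + v)) = Mat2 1 0 0 1"
    "Mat2 ((1 / 2) *\<^sub>R (u + v)) ((1 / 2) *\<^sub>R (u - v)) ((1 / 2) *\<^sub>R (u - v)) ((1 / 2) *\<^sub>R (u + v)) * Mat2 a b b a = Mat2 1 0 0 1"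
    by (simp_all only: times_mat2_def mat2.sel mult_scaleR_left mult_scaleR_right
        add.commute[of "b * _"] add.commute[of "_ * b"] half scaleR_zero_right flip: scaleR_add_right)
  then show "inv2 (Mat2 a b b a)" unfolding inv2_def by blast
qed

lemma positive_symmetric_mat2_iff:
  fixes a b :: "'a::cstar_algebra"
  assumes "star a = a" "star b = b"
  shows "positive (Mat2 a b b a) \<longleftrightarrow> positive (a + b) \<and> positive (a - b)"
proof -
  have sp: "z \<in> spectrum (Mat2 a b b a) \<longleftrightarrow> z = 0 \<or> z \<in> spectrum (a + b) \<or> z \<in> spectrum (a - b)" for z
  proof -
    have e: "unitize a - of_complex z + unitize b = unitize (a + b) - of_complex z"
      "unitize a - of_complex z - unitize b = unitize (a - b) - of_complex z"
      by (simp_all add: unitize_add unitize_diff)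
    show ?thesis
      using spectrum_mat2_iff[of z a b b a] unfolding inv2_symmetric_iff e
      by (auto simp: spectrum_eq_sp sp_def)
  qed
  have "(0::complex) \<in> complex_of_real ` {0..}" by (metis atLeast_iff imageI of_real_0 order_refl)
  then have "spectrum (Mat2 a b b a) \<subseteq> complex_of_real ` {0..} \<longleftrightarrow>
      spectrum (a + b) \<subseteq> complex_of_real ` {0..} \<and> spectrum (a - b) \<subseteq> complex_of_real ` {0..}"
    using sp by (auto simp: subset_iff)
  then show ?thesis using assms by (simp add: positive_def star_mat2_def star_add star_diff)
qed

text \<open>The Schur complements of the upper left corners, multiplied by \<open>t\<close>, form a path of
  self-adjoint elements that are invertible for \<open>t > 0\<close> and positive for large \<open>t\<close>.  Hence the end point
  \<open>- star x * (1 - p) * x\<close> at \<open>t = 0\<close> is positive as well.\<close>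

lemma corner_absorbs:
  fixes p x :: "'a::cstar_algebra_1"
  assumes p: "star p = p" "p * p = p" and k: "0 < k"
    and inv: "\<And>t. 0 < t \<Longrightarrow> inv2 (Mat2 (k *\<^sub>R p + of_real t) x (star x) (k *\<^sub>R p + of_real t))"
  shows "p * x = x"
proof -
  define q where "q = 1 - p"
  have q: "star q = q" "q * q = q" "p * q = 0" "q * p = 0" "p + q = 1"
    using p by (simp_all add: q_def star_diff algebra_simps)
  have one: "of_real t = t *\<^sub>R p + t *\<^sub>R q" for t
    by (simp add: of_real_def q(5) flip: scaleR_add_right)
  define y z where "y = star x * q * x" and "z = star x * p * x"
  \<comment> \<open>The inverse of the corner is \<open>p / (k + t) + q / t\<close>; the factor
    \<open>t\<close> cancels its pole at 0 and leaves \<open>- y\<close> there.\<close>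
  define f where "f t = (t * (k + t)) *\<^sub>R p + (t * t) *\<^sub>R q - y - (t / (k + t)) *\<^sub>R z" for t
  have syz: "star y = y" "star z = z"
    by (simp_all add: y_def z_def star_mult star_star p q mult.assoc)
  have sf: "star (f t) = f t" for t
    by (simp add: f_def star_diff star_add star_scaleR p q syz)
  \<comment> \<open>Large enough that \<open>f C\<close> differs from the scalar
    \<open>C * C\<close> by at most \<open>C * C\<close> in norm.\<close>
  define C where "C = k * norm p + norm y + norm z + 1"
  have C: "1 \<le> C" using k by (simp add: C_def)
  have "pos (f C)"
  proof (rule posI_norm[OF sf])
    have "of_real (C * C) - f C = - (((C * k) *\<^sub>R p) - y - (C / (k + C)) *\<^sub>R z)"
      by (simp only: f_def one[of "C * C"]) (simp add: algebra_simps)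
    then have "norm (of_real (C * C) - f C) = norm (((C * k) *\<^sub>R p) - y - (C / (k + C)) *\<^sub>R z)"
      by (simp only: norm_minus_cancel)
    also have "\<dots> \<le> norm ((C * k) *\<^sub>R p) + norm y + norm ((C / (k + C)) *\<^sub>R z)"
      by (meson norm_triangle_ineq4 order_trans add_mono order_refl)
    also have "\<dots> \<le> C * (k * norm p) + C * norm y + C * norm z"
    proof -
      have "C / (k + C) \<le> C" using C k by (simp add: divide_le_eq)
      then have "C / (k + C) * norm z \<le> C * norm z" by (rule mult_right_mono) simp
      moreover have "norm y \<le> C * norm y" using C mult_right_mono[of 1 C "norm y"] by simp
      ultimately show ?thesis using C k by simp
    qed
    also have "\<dots> \<le> C * C" using C unfolding C_def by (simp add: algebra_simps)
    finally show "norm (of_real (C * C) - f C) \<le> C * C" .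
  qed
  moreover have "has_inverse (f t)" if t: "0 < t" for t
  proof -
    have a: "k *\<^sub>R p + of_real t = (k + t) *\<^sub>R p + t *\<^sub>R q"
      unfolding one[of t] by (simp add: algebra_simps)
    define a' where "a' = (1 / (k + t)) *\<^sub>R p + (1 / t) *\<^sub>R q"
    have "k / (k + t) + t / (k + t) = 1"
      using t k by (simp flip: add_divide_distrib)
    then have "inverse_pair (k *\<^sub>R p + of_real t) a'"
      unfolding inverse_pair_def a a'_def using t k p q
      by (simp add: distrib_left distrib_right flip: scaleR_add_left)
    then have "has_inverse (k *\<^sub>R p + of_real t - star x * a' * x)"
      by (rule inv2_schur[OF inv[OF t]])
    then have "has_inverse (of_complex (complex_of_real t) * (k *\<^sub>R p + of_real t - star x * a' * x))"
      using t by (intro has_inverse_mult has_inverse_of_complex) simp_all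
    also have "of_complex (complex_of_real t) * (k *\<^sub>R p + of_real t - star x * a' * x)
        = t *\<^sub>R ((k + t) *\<^sub>R p + t *\<^sub>R q - star x * a' * x)"
      by (simp add: of_complex_mult_left a flip: scaleR_scaleC)
    also have "star x * a' * x = (1 / (k + t)) *\<^sub>R z + (1 / t) *\<^sub>R y"
      by (simp add: a'_def y_def z_def distrib_left distrib_right)
    also have "t *\<^sub>R ((k + t) *\<^sub>R p + t *\<^sub>R q - ((1 / (k + t)) *\<^sub>R z + (1 / t) *\<^sub>R y)) = f t"
      using t by (simp add: f_def scaleR_diff_right scaleR_add_right)
    finally show ?thesis .
  qed
  moreover have "continuous_on {0..C} f"
    unfolding f_def by (intro continuous_intros) (use k in auto)
  ultimately have "pos (f 0)" using C sf by (intro pos_path[of C f]) auto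
  moreover have y: "y = star (q * x) * (q * x)"
    by (simp add: y_def star_mult q(1)) (metis mult.assoc q(2))
  ultimately have "pos (- y)" "pos y" using pos_star_mult[of "q * x"] by (simp_all add: f_def)
  then have "star (q * x) * (q * x) = 0" using pos_uminus_imp_zero y by metis
  then have "q * x = 0" using cstar_identity[of "q * x"] by simp
  then show ?thesis by (simp add: q_def left_diff_distrib)
qed

text \<open>Put \<open>w = z - s\<close> and let X be the off-diagonal part. On the corner of
  \<open>p\<close> the matrix is X - w, inverted by X + w times the inverse of X^2 - w^2; on
  \<open>1 - p\<close> it is - z. The inverse of X^2 - w^2 exists: otherwise w^2 = r with r between
  0 and s^2, and \<open>z\<close> would be s + sqrt r or s - sqrt r, both nonnegative.\<close>

lemma inv2_corner:
  fixes p x :: "'a::cstar_algebra_1"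
  assumes p: "star p = p" "p * p = p" and x: "p * x = x" "x * p = x" and s: "norm x \<le> s"
    and z: "z \<notin> complex_of_real ` {0..}"
  shows "inv2 (Mat2 (s *\<^sub>R p - of_complex z) x (star x) (s *\<^sub>R p - of_complex z))"
proof -
  have right: "\<exists>N. Mat2 (s *\<^sub>R p - of_complex z) x (star x) (s *\<^sub>R p - of_complex z) * N = Mat2 1 0 0 1"
    if z: "z \<notin> complex_of_real ` {0..}" for z
  proof -
    define w where "w = z - complex_of_real s"
    have s0: "0 \<le> s" using s norm_ge_zero order_trans by blast
    have z0: "z \<noteq> 0" using z by (metis atLeast_iff imageI of_real_0 order_refl)
    have inv: "has_inverse (star u * u - of_complex (w\<^sup>2))" if u: "norm u \<le> s" for u :: 'a
    proof (rule ccontr)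
      assume "\<not> ?thesis"
      then have m: "w\<^sup>2 \<in> sp (star u * u)" by (simp add: sp_def)
      then obtain r where r: "0 \<le> r" "w\<^sup>2 = complex_of_real r" using pos_star_mult posE by blast
      have "r \<le> (norm u)\<^sup>2" using sp_norm_le[OF m] r by (simp add: cstar_identity)
      also have "\<dots> \<le> s\<^sup>2" using u by (simp add: power_mono)
      finally have "sqrt r \<le> s" using s0 real_le_lsqrt by blast
      have "w\<^sup>2 = (complex_of_real (sqrt r))\<^sup>2" using r by (simp flip: of_real_power)
      then have "w = complex_of_real (sqrt r) \<or> w = - complex_of_real (sqrt r)"
        by (simp only: power2_eq_iff)
      then have "z = complex_of_real (s + sqrt r) \<or> z = complex_of_real (s - sqrt r)"
        unfolding w_def of_real_add of_real_diff by (auto simp: algebra_simps)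
      moreover have "0 \<le> s + sqrt r" "0 \<le> s - sqrt r" using \<open>sqrt r \<le> s\<close> r(1) s0 by simp_all
      ultimately show False using z by (metis atLeast_iff imageI)
    qed
    obtain R1 where "inverse_pair (star (star x) * star x - of_complex (w\<^sup>2)) R1"
      using inv[of "star x"] s by (auto simp: has_inverse_def)
    then have R1: "x * star x * R1 = 1 + w\<^sup>2 *\<^sub>C R1"
      by (simp add: inverse_pair_def star_star left_diff_distrib of_complex_mult_left diff_eq_eq)
    obtain R2 where "inverse_pair (star x * x - of_complex (w\<^sup>2)) R2"
      using inv[of x] s by (auto simp: has_inverse_def)
    then have R2: "star x * x * R2 = 1 + w\<^sup>2 *\<^sub>C R2"
      by (simp add: inverse_pair_def left_diff_distrib of_complex_mult_left diff_eq_eq)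
    have x': "p * star x = star x" "star x * p = star x"
      using x star_mult[of x p] star_mult[of p x] p by simp_all
    define q where "q = 1 - p"
    have q: "p * q = 0" "q * p = 0" "q * q = q" "q * x = 0" "x * q = 0" "q * star x = 0" "star x * q = 0" "p + q = 1"
      using p x x' by (simp_all add: q_def algebra_simps)
    have D: "s *\<^sub>R p - of_complex z = - (w *\<^sub>C p) - z *\<^sub>C q"
      by (simp add: w_def q_def of_complex_def scaleR_scaleC scaleC_diff_left scaleC_diff_right)
    have "p * (x * star x * R1) = x * star x * R1" "p * (star x * x * R2) = star x * x * R2"
      using x(1) x'(1) by (simp_all flip: mult.assoc)
    then have e: "x * (star x * R1) = p + w\<^sup>2 *\<^sub>C (p * R1)" "star x * (x * R2) = p + w\<^sup>2 *\<^sub>C (p * R2)"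
      unfolding R1 R2 by (simp_all add: R1 R2 distrib_left mult_scaleC_right flip: mult.assoc)
    \<comment> \<open>\<open>R1\<close> and \<open>R2\<close> are inverses in the whole algebra;
      multiplying by \<open>p\<close> on the left cuts them down to the corner, and \<open>q\<close>
      carries the inverse of \<open>- z\<close>.\<close>
    let ?N = "Mat2 (w *\<^sub>C (p * R1) - inverse z *\<^sub>C q) (x * R2) (star x * R1) (w *\<^sub>C (p * R2) - inverse z *\<^sub>C q)"
    have as: "a * b = c \<Longrightarrow> a * (b * d) = c * d" for a b c d :: 'a by (simp flip: mult.assoc)
    have "Mat2 (s *\<^sub>R p - of_complex z) x (star x) (s *\<^sub>R p - of_complex z) * ?N = Mat2 1 0 0 1"
      unfolding D using z0
      by (simp add: times_mat2_def e left_diff_distrib right_diff_distrib mult_scaleC_left mult_scaleC_right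
          scaleC_scaleC scaleC_one q p x x' as[OF p(2)] as[OF q(2)] as[OF x(1)] as[OF x(2)] as[OF x'(1)]
          as[OF x'(2)] as[OF q(4)] as[OF q(6)] power2_eq_square scaleC_minus_right)
        (simp add: q_def)
    then show ?thesis by blast
  qed
  \<comment> \<open>So far only right inverses are known. The adjoint of a right inverse at
    \<open>cnj z\<close> is a left inverse at \<open>z\<close>.\<close>
  let ?M = "\<lambda>z. Mat2 (s *\<^sub>R p - of_complex z) x (star x) (s *\<^sub>R p - of_complex z)"
  obtain N where N: "?M z * N = Mat2 1 0 0 1" using right[OF z] by blast
  have "cnj z \<notin> complex_of_real ` {0..}" using z by (metis complex_cnj_cnj complex_cnj_complex_of_real imageE imageI)
  then obtain L where "?M (cnj z) * L = Mat2 1 0 0 1" using right by blast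
  then have "star L * star (?M (cnj z)) = star (Mat2 1 0 0 1)" by (metis star_mult)
  then have L: "star L * ?M z = Mat2 1 0 0 1"
    by (simp add: star_mat2_def star_diff star_scaleR p star_of_complex star_star)
  have unit: "Mat2 1 0 0 1 * K = K" "K * Mat2 1 0 0 1 = K" for K :: "'a mat2"
    by (simp_all add: times_mat2_def)
  have "star L = N" by (metis L N mult.assoc unit)
  then show ?thesis using L N by (auto simp: inv2_def)
qed

text \<open>Membership yields absorption through \<open>corner_absorbs\<close>, applied to
  \<open>x\<close> and to \<open>star x\<close>. Absorption in turn yields positivity for every
  coefficient \<open>s \<ge> norm x\<close> through \<open>inv2_corner\<close>, in particular for
  \<open>norm x\<close> itself.\<close>

lemma projection_dominated_iff:
  fixes p :: "'a::cstar_algebra"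
  assumes "is_projection p"
  shows "x \<in> dominated_by p \<longleftrightarrow> p * x = x \<and> x * p = x"
    and "x \<in> dominated_by p \<Longrightarrow> positive (Mat2 (norm x *\<^sub>R p) x (star x) (norm x *\<^sub>R p))"
proof -
  let ?p = "unitize p" and ?x = "unitize x"
  have p: "star ?p = ?p" "?p * ?p = ?p"
    using assms by (simp_all add: is_projection_def flip: unitize_star unitize_mult)
  have absorb: "p * x = x \<and> x * p = x" if d: "x \<in> dominated_by p"
  proof -
    obtain k where k: "0 < k" "positive (Mat2 (k *\<^sub>R p) x (star x) (k *\<^sub>R p))"
      using d by (auto simp: dominated_by_def)
    have inv: "inv2 (Mat2 (k *\<^sub>R ?p + of_real t) ?x (star ?x) (k *\<^sub>R ?p + of_real t))" if t: "0 < t" for t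
    proof -
      have "- complex_of_real t \<notin> complex_of_real ` {0..}"
        using t by (auto simp flip: of_real_minus)
      then have "- complex_of_real t \<notin> spectrum (Mat2 (k *\<^sub>R p) x (star x) (k *\<^sub>R p))"
        using k(2) by (auto simp: positive_def)
      then show ?thesis
        by (simp add: spectrum_mat2_iff unitize_scaleR unitize_star of_complex_minus of_real_of_complex)
    qed
    have "?p * ?x = ?x" by (rule corner_absorbs[OF p k(1) inv])
    moreover have "?p * star ?x = star ?x"
      by (rule corner_absorbs[OF p k(1)]) (simp add: star_star inv2_swap inv)
    then have "?x * ?p = ?x" by (metis star_mult star_star p(1))
    ultimately show ?thesis by (simp flip: unitize_mult)
  qed
  have positive: "positive (Mat2 (s *\<^sub>R p) x (star x) (s *\<^sub>R p))"
    if x: "p * x = x \<and> x * p = x" and s: "norm x \<le> s" for s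
    unfolding positive_def
  proof (intro conjI subsetI)
    show "star (Mat2 (s *\<^sub>R p) x (star x) (s *\<^sub>R p)) = Mat2 (s *\<^sub>R p) x (star x) (s *\<^sub>R p)"
      using assms by (simp add: star_mat2_def star_scaleR star_star is_projection_def)
    fix z assume z: "z \<in> spectrum (Mat2 (s *\<^sub>R p) x (star x) (s *\<^sub>R p))"
    show "z \<in> complex_of_real ` {0..}"
    proof (rule ccontr)
      assume n: "z \<notin> complex_of_real ` {0..}"
      then have "z \<noteq> 0" by (metis atLeast_iff imageI of_real_0 order_refl)
      moreover have "?p * ?x = ?x" "?x * ?p = ?x" using x by (simp_all flip: unitize_mult)
      then have "inv2 (Mat2 (s *\<^sub>R ?p - of_complex z) ?x (star ?x) (s *\<^sub>R ?p - of_complex z))"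
        using s n by (intro inv2_corner p) simp_all
      ultimately show False
        using z spectrum_mat2_iff[of z "s *\<^sub>R p" x "star x" "s *\<^sub>R p"] by (simp add: unitize_scaleR unitize_star)
    qed
  qed
  show "x \<in> dominated_by p \<longleftrightarrow> p * x = x \<and> x * p = x"
  proof
    assume "p * x = x \<and> x * p = x"
    \<comment> \<open>The coefficient has to be strictly positive even when
      \<open>x = 0\<close>.\<close>
    then have "positive (Mat2 ((norm x + 1) *\<^sub>R p) x (star x) ((norm x + 1) *\<^sub>R p))" by (rule positive) simp
    moreover have "0 < norm x + 1" by (simp add: add_nonneg_pos)
    ultimately show "x \<in> dominated_by p" unfolding dominated_by_def by blast
  qed (rule absorb)
  show "positive (Mat2 (norm x *\<^sub>R p) x (star x) (norm x *\<^sub>R p))" if "x \<in> dominated_by p"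
    using positive[OF absorb[OF that]] by simp
qed

subsection \<open>Projections and the order unit property\<close>

text \<open>The order unit property for \<open>x = p - p\<^sup>2\<close> with norm \<open>s\<close> gives \<open>1 - r \<le> s\<close> for
  all nonzero \<open>r\<close> in the spectrum of \<open>p\<close>, whereas \<open>s = r (1 - r)\<close> for some \<open>r\<close> in the spectrum.\<close>

lemma order_unit_imp_projection:
  fixes p :: "'a::cstar_algebra"
  assumes "order_unit_property p"
  shows "is_projection p"
proof -
  let ?p = "unitize p"
  define x where "x = p - p * p"
  define s where "s = norm x"
  have pp: "pos ?p" and n1: "norm ?p = 1"
    using assms by (simp_all add: order_unit_property_def positive_iff_pos)
  have sp: "star p = p"
    using assms by (simp add: order_unit_property_def positive_def)
  have r1: "r \<le> 1" if "complex_of_real r \<in> sp ?p" for r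
    using sp_norm_le[OF that] n1 by simp
  have sx: "star x = x" by (simp add: x_def star_diff star_mult sp)
  have ex: "unitize x = peval [:0, 1, -1:] ?p"
    by (simp add: x_def unitize_diff unitize_mult algebra_simps of_complex_minus)
  have spx: "\<exists>r. complex_of_real r \<in> sp ?p \<and> 0 \<le> r \<and> z = complex_of_real (r - r * r)"
    if z: "z \<in> sp (unitize x)" for z
  proof -
    obtain y where y: "y \<in> sp ?p" "poly [:0, 1, -1:] y = z" using sp_pevalE[OF z[unfolded ex]] by auto
    obtain r where "0 \<le> r" "y = complex_of_real r" using posE[OF pp y(1)] .
    with y show ?thesis by (intro exI[of _ r]) (simp add: algebra_simps)
  qed
  have "pos (unitize x)"
  proof (rule posI)
    show "star (unitize x) = unitize x" by (simp add: sx flip: unitize_star)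
    fix t assume "complex_of_real t \<in> sp (unitize x)"
    then obtain r where r: "complex_of_real r \<in> sp ?p" "0 \<le> r" "t = r - r * r"
      using spx by (metis of_real_eq_iff)
    then show "0 \<le> t" using r1[OF r(1)] by (simp add: mult_left_le)
  qed
  \<comment> \<open>\<open>p - x\<close> is the square of \<open>p\<close>, and \<open>p + x\<close>
    is a sum of positive elements; hence \<open>k = 1\<close> shows that \<open>x\<close> is
    dominated.\<close>
  then have "positive (p + x)" "positive (p - x)"
    using pos_add[OF pp] pos_square[of ?p] pos_star[OF pp]
    by (simp_all add: positive_iff_pos unitize_add) (simp add: x_def flip: unitize_mult)
  then have "positive (Mat2 (1 *\<^sub>R p) x (star x) (1 *\<^sub>R p))"
    by (simp add: sx positive_symmetric_mat2_iff sp)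
  then have "x \<in> dominated_by p" unfolding dominated_by_def using zero_less_one by blast
  then have "positive (Mat2 (s *\<^sub>R p) x (star x) (s *\<^sub>R p))"
    using assms by (simp add: order_unit_property_def s_def)
  then have q: "pos (unitize (s *\<^sub>R p - x))"
    by (simp add: sx positive_symmetric_mat2_iff sp star_scaleR positive_iff_pos)
  \<comment> \<open>At a spectral value \<open>r\<close> of \<open>p\<close> this polynomial equals
    \<open>r * (s - 1 + r)\<close>, and positivity makes it nonnegative.\<close>
  have "unitize (s *\<^sub>R p - x) = peval [:0, complex_of_real (s - 1), 1:] ?p"
    by (simp add: x_def unitize_diff unitize_scaleR unitize_mult of_complex_diff)
      (simp add: algebra_simps of_complex_mult_right flip: scaleR_scaleC)
  then have "complex_of_real r \<in> sp ?p \<Longrightarrow> 0 \<le> r * (s - 1) + r * r" for r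
    using posD[OF q, of "r * (s - 1) + r * r"] poly_in_sp_peval[of "complex_of_real r" ?p "[:0, complex_of_real (s - 1), 1:]"]
    by (simp add: algebra_simps)
  then have gap: "r = 0 \<or> 1 - s \<le> r" if "complex_of_real r \<in> sp ?p" for r
  proof -
    have "0 \<le> r" using posD[OF pp that] .
    moreover have "0 \<le> r * (s - 1 + r)" using \<open>\<And>r. _ \<Longrightarrow> 0 \<le> r * (s - 1) + r * r\<close>[OF that] by (simp add: algebra_simps)
    ultimately show ?thesis by (auto simp: zero_le_mult_iff)
  qed
  have "star (unitize x) = unitize x" by (simp add: sx flip: unitize_star)
  then obtain z where z: "z \<in> sp (unitize x)" "cmod z = norm (unitize x)" by (rule sp_norm_attained)
  obtain r where r: "complex_of_real r \<in> sp ?p" "0 \<le> r" "z = complex_of_real (r - r * r)"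
    using spx[OF z(1)] by blast
  have "r * r \<le> r" using r r1[OF r(1)] by (simp add: mult_left_le)
  then have s: "s = r - r * r" using z(2) unfolding r(3) norm_of_real by (simp add: s_def)
  \<comment> \<open>With \<open>s = r - r * r\<close>, the bound \<open>1 - s \<le> r\<close>
    becomes \<open>(1 - r) * (1 - r) \<le> 0\<close>, so \<open>r\<close> is 0 or 1.\<close>
  have "s = 0"
  proof (cases "r = 0")
    case False
    then have "(1 - r) * (1 - r) \<le> 0" using gap[OF r(1)] s by (simp add: algebra_simps)
    then have "r = 1" by (auto simp: mult_le_0_iff)
    then show ?thesis using s by simp
  qed (simp add: s)
  then show ?thesis using sp by (simp add: s_def x_def is_projection_def)
qed

theorem theorem3p4:
  fixes p :: "'a::cstar_algebra"
  assumes "positive p" and "norm p = 1"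
  shows "(order_unit_property p \<longleftrightarrow> is_projection p) \<and>
    (is_projection p \<longrightarrow> dominated_by p = {p * x * p | x. True})"
proof (intro conjI impI iffI)
  show "is_projection p" if "order_unit_property p"
    using that by (rule order_unit_imp_projection)
  assume p: "is_projection p"
  show "order_unit_property p"
    using assms projection_dominated_iff(2)[OF p] by (simp add: order_unit_property_def)
  have pp: "p * p = p" using p by (simp add: is_projection_def)
  show "dominated_by p = {p * x * p | x. True}"
  proof (intro subset_antisym subsetI)
    fix x assume "x \<in> dominated_by p"
    then have "x = p * x * p" using projection_dominated_iff(1)[OF p] by simp
    then show "x \<in> {p * x * p | x. True}" by blast
  next
    fix x assume "x \<in> {p * x * p | x. True}"
    then obtain y where x: "x = p * y * p" by auto
    have "p * x = x" unfolding x by (simp add: pp flip: mult.assoc)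
    moreover have "x * p = x" unfolding x by (simp add: pp mult.assoc)
    ultimately have "p * x = x \<and> x * p = x" ..
    then show "x \<in> dominated_by p" using projection_dominated_iff(1)[OF p] by simp
  qed
qed

end
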